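(* For $x,y\in V$ and $t\in\mathbb{R}$ one has $$\exp(tL_x)y=\exp(t\underline x)\,y\,\exp(t\underline x)^{\top}.$$ In particular, $$\mathrm{Exp}_\Delta(x):=\exp(L_x)e=\exp(\underline x)\exp(\underline x)^{\top}=\Phi\bigl(\exp(\underline x)\bigr).$$ Hence the clan exponential $\mathrm{Exp}_\Delta:V\to\Omega$ is a diffeomorphism, with inverse the clan logarithm $$\mathrm{Log}_\Delta(x)=\log(T_x)+\log(T_x)^{\top},\qquad x\in\Omega.$$
   Context: Let $V\subset \mathrm{Sym}(3,\mathbb{R})$ be the 5-dimensional space of real symmetric $3\times3$ matrices whose $(1,2)$ and $(2,1)$ entries are $0$, let $e=I_3$, and let $\Omega\subset V$ be the open cone of positive definite matrices in $V$. Let $H$ be the group of real lower triangular $3\times 3$ matrices with positive diagonal entries and zero $(2,1)$ entry, with Lie algebra $\mathfrak{h}$ the lower triangular $3\times3$ matrices with zero $(2,1)$ entry. The map $\Phi:H\to\Omega$, $\Phi(T)=TT^{\top}$, is a diffeomorphism; $T_x:=\Phi^{-1}(x)\in H$ is the lower Cholesky factor. For $x\in V$ let $\underline{x}\in\mathfrak h$ be the unique element with $x=\underline x+\underline x^{\top}$. The clan product on $V$ is $x\Delta y=\underline x\,y+y\,\underline x^{\top}$, and $L_x:V\to V$ is $L_x(y)=x\Delta y$; $\exp(tL_x)$ is the exponential of this linear operator. On $H$, $\log$ is the principal matrix logarithm. *)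

theory Defs
  imports "HOL-Analysis.Analysis"
begin

section \<open>Exponentials of operators and matrices\<close>

text \<open>The exponential series of a linear operator, evaluated at a vector. On a finite-dimensional
  space its pointwise convergence is the same as convergence in operator norm. If the operator
  leaves a subspace invariant, all terms of the series at a point of that subspace depend only on
  the restriction of the operator to it.\<close>

definition op_exp :: "('a::real_normed_vector \<Rightarrow> 'a) \<Rightarrow> 'a \<Rightarrow> 'a" where
  "op_exp A y = (\<Sum>n. (A ^^ n) y /\<^sub>R fact n)"

text \<open>Multiplication on \<open>real ^ 'n ^ 'n\<close> in the class \<open>times\<close> is componentwise, so neither
  \<open>exp\<close> nor \<open>(^)\<close> may be used here: \<open>((**) A ^^ n) (mat 1)\<close> is the n-th matrix power.\<close>

definition matrix_exp :: "real ^ 'n ^ 'n \<Rightarrow> real ^ 'n ^ 'n" where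
  "matrix_exp A = (\<Sum>n. ((**) A ^^ n) (mat 1) /\<^sub>R fact n)"

lemma op_exp_sums:
  fixes A :: "'a::euclidean_space \<Rightarrow> 'a"
  assumes "linear A"
  shows "(\<lambda>n. (A ^^ n) y /\<^sub>R fact n) sums op_exp A y"
proof -
  have "bounded_linear A" using assms by (simp add: linear_conv_bounded_linear)
  then obtain K where K: "\<And>x. norm (A x) \<le> norm x * K" "K \<ge> 0"
    using bounded_linear.nonneg_bounded by metis
  have bound: "norm ((A ^^ n) y) \<le> K ^ n * norm y" for n
  proof (induction n)
    case (Suc n)
    have "norm (A ((A ^^ n) y)) \<le> norm ((A ^^ n) y) * K" by (rule K)
    also have "\<dots> \<le> (K ^ n * norm y) * K" by (rule mult_right_mono[OF Suc K(2)])
    finally show ?case by (simp add: mult_ac)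
  qed simp
  have "summable (\<lambda>n. norm y * (K ^ n /\<^sub>R fact n))"
    by (intro summable_mult summable_exp_generic)
  then have "summable (\<lambda>n. (A ^^ n) y /\<^sub>R fact n)"
  proof (rule summable_comparison_test')
    show "norm ((A ^^ n) y /\<^sub>R fact n) \<le> norm y * (K ^ n /\<^sub>R fact n)" for n
      using bound[of n] by (simp add: field_simps)
  qed
  then show ?thesis unfolding op_exp_def by (rule summable_sums)
qed

lemma matrix_exp_sums: "(\<lambda>n. ((**) A ^^ n) (mat 1) /\<^sub>R fact n) sums matrix_exp A"
proof -
  have "linear ((**) A)"
    by (rule linearI) (simp_all add: matrix_matrix_mult_def vec_eq_iff algebra_simps sum.distrib sum_distrib_left)
  from op_exp_sums[OF this, of "mat 1"] show ?thesis
    unfolding op_exp_def matrix_exp_def .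
qed


section \<open>The principal matrix logarithm\<close>

definition complex_eigenvalue :: "real ^ 'n ^ 'n \<Rightarrow> complex \<Rightarrow> bool" where
  "complex_eigenvalue A z \<longleftrightarrow>
     (\<exists>v :: complex ^ 'n. v \<noteq> 0 \<and> map_matrix complex_of_real A *v v = z *s v)"

text \<open>A matrix without eigenvalues on the closed negative real axis has exactly one logarithm
  with spectrum in the strip \<open>\<bar>Im z\<bar> < pi\<close>, the principal one. For a real matrix it is real, so the
  search may be restricted to real matrices.\<close>

definition principal_log :: "real ^ 'n ^ 'n \<Rightarrow> real ^ 'n ^ 'n" where
  "principal_log A =
     (THE X. matrix_exp X = A \<and> (\<forall>z. complex_eigenvalue X z \<longrightarrow> \<bar>Im z\<bar> < pi))"


section \<open>Smooth maps between subsets of Euclidean spaces\<close>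

text \<open>\<open>Ck_on k U f\<close> is the usual notion of a k times continuously differentiable map on the open
  set \<open>U\<close>: all iterated directional derivatives up to order \<open>k\<close> exist and are continuous.\<close>

primrec Ck_on ::
  "nat \<Rightarrow> 'a::euclidean_space set \<Rightarrow> ('a \<Rightarrow> 'b::euclidean_space) \<Rightarrow> bool" where
  "Ck_on 0 U f \<longleftrightarrow> continuous_on U f"
| "Ck_on (Suc k) U f \<longleftrightarrow>
     (\<forall>x\<in>U. f differentiable (at x)) \<and> (\<forall>v. Ck_on k U (\<lambda>x. frechet_derivative f (at x) v))"

text \<open>A map on an arbitrary subset of a Euclidean space is smooth if it extends locally to a smooth
  map on an open set. On relatively open subsets of a linear subspace this agrees with smoothness
  in linear coordinates of that subspace.\<close>

definition smooth_map_on ::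
  "'a::euclidean_space set \<Rightarrow> ('a \<Rightarrow> 'b::euclidean_space) \<Rightarrow> bool" where
  "smooth_map_on S f \<longleftrightarrow>
     (\<forall>x\<in>S. \<exists>U g. open U \<and> x \<in> U \<and> (\<forall>k. Ck_on k U g) \<and> (\<forall>y\<in>S \<inter> U. g y = f y))"

definition diffeomorphism ::
  "'a::euclidean_space set \<Rightarrow> 'b::euclidean_space set \<Rightarrow> ('a \<Rightarrow> 'b) \<Rightarrow> ('b \<Rightarrow> 'a) \<Rightarrow> bool" where
  "diffeomorphism S T f g \<longleftrightarrow>
     (\<forall>x\<in>S. g (f x) = x) \<and> f ` S = T \<and> smooth_map_on S f \<and>
     (\<forall>y\<in>T. f (g y) = y) \<and> g ` T = S \<and> smooth_map_on T g"


section \<open>The clan\<close>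

text \<open>In the index type \<open>3\<close> the numeral \<open>3\<close> equals \<open>0\<close> and hence is the least element, so
  triangularity is spelled out entrywise.\<close>

definition clan_V :: "(real ^ 3 ^ 3) set" where
  "clan_V = {x. transpose x = x \<and> x $ 1 $ 2 = 0 \<and> x $ 2 $ 1 = 0}"

definition clan_Omega :: "(real ^ 3 ^ 3) set" where
  "clan_Omega = {x \<in> clan_V. \<forall>v. v \<noteq> 0 \<longrightarrow> v \<bullet> (x *v v) > 0}"

definition clan_h :: "(real ^ 3 ^ 3) set" where
  "clan_h = {T. T $ 1 $ 2 = 0 \<and> T $ 1 $ 3 = 0 \<and> T $ 2 $ 3 = 0 \<and> T $ 2 $ 1 = 0}"

definition clan_H :: "(real ^ 3 ^ 3) set" where
  "clan_H = {T \<in> clan_h. \<forall>i. T $ i $ i > 0}"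

definition clan_Phi :: "real ^ 3 ^ 3 \<Rightarrow> real ^ 3 ^ 3" where
  "clan_Phi T = T ** transpose T"

definition cholesky :: "real ^ 3 ^ 3 \<Rightarrow> real ^ 3 ^ 3" where
  "cholesky = the_inv_into clan_H clan_Phi"

definition lower_part :: "real ^ 3 ^ 3 \<Rightarrow> real ^ 3 ^ 3" where
  "lower_part x = (THE u. u \<in> clan_h \<and> x = u + transpose u)"

lemma lower_part_unique:
  assumes "x \<in> clan_V"
  shows "\<exists>!u. u \<in> clan_h \<and> x = u + transpose u"
proof -
  define u where "u = (\<chi> i j. if i = j then x $ i $ i / 2
    else if i = 3 then x $ i $ j else 0)"
  have *: "x $ 1 $ 2 = 0" "x $ 2 $ 1 = 0" "x $ 1 $ 3 = x $ 3 $ 1" "x $ 2 $ 3 = x $ 3 $ 2"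
    using assms by (auto simp: clan_V_def transpose_def vec_eq_iff)
  show ?thesis
  proof (rule ex1I[of _ u])
    show "u \<in> clan_h \<and> x = u + transpose u"
      using * by (simp add: u_def clan_h_def transpose_def vec_eq_iff forall_3)
  next
    fix w assume "w \<in> clan_h \<and> x = w + transpose w"
    then show "w = u"
      by (auto simp: u_def clan_h_def transpose_def vec_eq_iff forall_3)
  qed
qed

definition clan_prod :: "real ^ 3 ^ 3 \<Rightarrow> real ^ 3 ^ 3 \<Rightarrow> real ^ 3 ^ 3" where
  "clan_prod x y = lower_part x ** y + y ** transpose (lower_part x)"

definition clan_L :: "real ^ 3 ^ 3 \<Rightarrow> real ^ 3 ^ 3 \<Rightarrow> real ^ 3 ^ 3" where
  "clan_L x = (\<lambda>y. clan_prod x y)"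

definition clan_Exp :: "real ^ 3 ^ 3 \<Rightarrow> real ^ 3 ^ 3" where
  "clan_Exp x = op_exp (clan_L x) (mat 1)"

definition clan_Log :: "real ^ 3 ^ 3 \<Rightarrow> real ^ 3 ^ 3" where
  "clan_Log = the_inv_into clan_V clan_Exp"

lemma clan_L_invariant:
  assumes "x \<in> clan_V" "y \<in> clan_V"
  shows "clan_L x y \<in> clan_V"
proof -
  have "lower_part x \<in> clan_h"
    using theI'[OF lower_part_unique[OF assms(1)]] by (simp add: lower_part_def)
  then have u: "lower_part x $ 1 $ 2 = 0" "lower_part x $ 1 $ 3 = 0"
      "lower_part x $ 2 $ 3 = 0" "lower_part x $ 2 $ 1 = 0"
    by (simp_all add: clan_h_def)
  have y: "transpose y = y" "y $ 1 $ 2 = 0" "y $ 2 $ 1 = 0"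
    using assms(2) by (simp_all add: clan_V_def)
  have tr: "transpose (a + b) = transpose a + transpose b" for a b :: "real ^ 3 ^ 3"
    by (simp add: transpose_def vec_eq_iff)
  have "transpose (clan_L x y) = clan_L x y"
    by (simp add: clan_L_def clan_prod_def tr matrix_transpose_mul y(1) add.commute)
  moreover have "clan_L x y $ 1 $ 2 = 0" "clan_L x y $ 2 $ 1 = 0"
    by (simp_all add: clan_L_def clan_prod_def matrix_matrix_mult_def transpose_def sum_3 u y(2,3))
  ultimately show ?thesis by (simp add: clan_V_def)
qed

end

theory Submission
  imports Defs "HOL-Computational_Algebra.Fundamental_Theorem_Algebra"
begin

text \<open>The curve \<open>exp (t u) y exp (t u)\<^sup>T\<close> solves \<open>z' = u z + z u\<^sup>T\<close>, so it equals \<open>exp (t L) y\<close> by uniqueness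
  for linear ODEs. With \<open>\<psi>(s) = (e\<^sup>s - 1) / s\<close> the exponential of a lower triangular matrix in \<open>h\<close>
  has off-diagonal entries of the form \<open>p e\<^sup>c \<psi>(a - c)\<close>; since \<open>\<psi>\<close> is smooth and positive, the
  clan exponential and its inverse are explicit smooth functions of the entries.

  For the principal logarithm, let \<open>exp X = exp u\<close> with the spectrum of \<open>X\<close> in the open strip and
  \<open>u\<close> in \<open>h\<close>. The eigenvalues of \<open>exp u\<close> are positive, so those of \<open>X\<close> are real. Then \<open>\<psi>(X - s)\<close> is
  injective for real \<open>s\<close>, because an eigenvector of \<open>X\<close> in its kernel would give a zero of \<open>\<psi>\<close>.
  Cancelling it in \<open>\<psi>(X - s) (X - s) v = exp (X - s) v - v\<close> shows that \<open>X\<close> and \<open>u\<close> agree on each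
  basis vector.\<close>

section \<open>Exponentials and linear differential equations\<close>

lemma funpow_scaleR_linear:
  fixes A :: "'a::real_vector \<Rightarrow> 'a"
  assumes "linear A"
  shows "((\<lambda>z. t *\<^sub>R A z) ^^ n) y = t ^ n *\<^sub>R (A ^^ n) y"
  by (induction n) (simp_all add: linear_scale[OF assms])

text \<open>Each coordinate of the curve is an everywhere convergent power series in t, so termwise
  differentiation applies; \<open>diffs c\<close> is what remains after one application of
  \<open>A\<close>.\<close>

lemma op_exp_has_vector_derivative:
  fixes A :: "'a::euclidean_space \<Rightarrow> 'a"
  assumes A: "linear A"
  shows "((\<lambda>t. op_exp (\<lambda>z. t *\<^sub>R A z) y) has_vector_derivative
           A (op_exp (\<lambda>z. t *\<^sub>R A z) y)) (at t)"
proof -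
  have tA: "linear (\<lambda>z. t *\<^sub>R A z)" for t
    using linear_compose_scale_right[OF A] by (simp add: o_def)
  have "((\<lambda>t. op_exp (\<lambda>z. t *\<^sub>R A z) y \<bullet> i) has_derivative
           (\<lambda>h. (h *\<^sub>R A (op_exp (\<lambda>z. t *\<^sub>R A z) y)) \<bullet> i)) (at t)" for i
  proof -
    define c where "c n = (A ^^ n) y \<bullet> i / fact n" for n
    have sm: "(\<lambda>n. c n * t ^ n) sums (op_exp (\<lambda>z. t *\<^sub>R A z) y \<bullet> i)" for t
    proof -
      have "(\<lambda>n. (((\<lambda>z. t *\<^sub>R A z) ^^ n) y /\<^sub>R fact n) \<bullet> i) sums (op_exp (\<lambda>z. t *\<^sub>R A z) y \<bullet> i)"
        by (rule bounded_linear.sums[OF bounded_linear_inner_left op_exp_sums[OF tA]])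
      then show ?thesis
        by (simp add: funpow_scaleR_linear[OF A] c_def field_simps)
    qed
    have "(\<lambda>n. A (((\<lambda>z. t *\<^sub>R A z) ^^ n) y /\<^sub>R fact n) \<bullet> i) sums (A (op_exp (\<lambda>z. t *\<^sub>R A z) y) \<bullet> i)"
      using A by (intro bounded_linear.sums[OF bounded_linear_inner_left] op_exp_sums[OF tA]
          bounded_linear.sums[of A]) (simp add: linear_conv_bounded_linear)
    moreover have "A (((\<lambda>z. t *\<^sub>R A z) ^^ n) y /\<^sub>R fact n) \<bullet> i = diffs c n * t ^ n" for n
      by (simp add: funpow_scaleR_linear[OF A] c_def diffs_def linear_scale[OF A])
        (simp add: field_simps flip: of_nat_Suc)
    ultimately have df: "(\<Sum>n. diffs c n * t ^ n) = A (op_exp (\<lambda>z. t *\<^sub>R A z) y) \<bullet> i"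
      by (simp add: sums_iff)
    have "((\<lambda>t. \<Sum>n. c n * t ^ n) has_real_derivative (\<Sum>n. diffs c n * t ^ n)) (at t)"
      by (rule termdiffs_strong_converges_everywhere) (rule sums_summable[OF sm])
    moreover have "(\<lambda>t. \<Sum>n. c n * t ^ n) = (\<lambda>t. op_exp (\<lambda>z. t *\<^sub>R A z) y \<bullet> i)"
      using sm by (auto simp: sums_iff)
    ultimately show ?thesis
      by (simp add: df has_field_derivative_def mult.commute[of _ "A _ \<bullet> i"])
  qed
  then show ?thesis
    unfolding has_vector_derivative_def
    by (subst has_derivative_componentwise_within) auto
qed

lemma op_exp_zero: "op_exp (\<lambda>z. 0) y = (y :: 'a::real_normed_vector)"
proof -
  have "((\<lambda>z :: 'a. 0 :: 'a) ^^ n) y /\<^sub>R fact n = 0" if "n \<notin> {0}" for n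
    using that by (cases n) auto
  then show ?thesis
    unfolding op_exp_def by (subst suminf_finite[of "{0}"]) auto
qed

text \<open>A Gronwall argument: the difference d of the two solutions satisfies the same linear
  equation with d 0 = 0, and a weighted square of its norm cannot grow.\<close>

lemma op_exp_ode_unique:
  fixes A :: "'a::euclidean_space \<Rightarrow> 'a"
  assumes A: "linear A"
    and g: "\<And>t. (g has_vector_derivative A (g t)) (at t)" "g 0 = y"
  shows "op_exp A y = g 1"
proof -
  obtain K where K: "\<And>x. norm (A x) \<le> norm x * K"
    using bounded_linear.bounded[of A] A by (auto simp: linear_conv_bounded_linear)
  define d where "d t = g t - op_exp (\<lambda>z. t *\<^sub>R A z) y" for t
  have d': "(d has_vector_derivative A (d t)) (at t)" for t
    unfolding d_def linear_diff[OF A]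
    by (intro has_vector_derivative_diff g(1) op_exp_has_vector_derivative[OF A])
  \<comment> \<open>The derivative of the squared norm of d is at most 2 K times that squared norm;
    the exponential weight compensates exactly this growth.\<close>
  define h where "h t = exp (- 2 * K * t) * (d t \<bullet> d t)" for t
  define h' where "h' t = exp (- 2 * K * t) * (2 * (d t \<bullet> A (d t)) - 2 * K * (d t \<bullet> d t))" for t
  have "(h has_real_derivative h' t) (at t)" for t
  proof -
    have "((\<lambda>t. d t \<bullet> d t) has_derivative (\<lambda>s. d t \<bullet> (s *\<^sub>R A (d t)) + (s *\<^sub>R A (d t)) \<bullet> d t)) (at t)"
      using d'[of t] unfolding has_vector_derivative_def by (intro has_derivative_inner)
    then have "((\<lambda>t. d t \<bullet> d t) has_real_derivative (2 * (d t \<bullet> A (d t)))) (at t)"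
      by (rule has_derivative_imp_has_field_derivative) (simp add: inner_commute)
    then show ?thesis
      unfolding h_def h'_def by - (rule derivative_eq_intros refl | assumption | simp add: algebra_simps)+
  qed
  note h' = this
  have "h' t \<le> 0" for t
  proof -
    have "d t \<bullet> A (d t) \<le> norm (d t) * norm (A (d t))" by (rule norm_cauchy_schwarz)
    also have "\<dots> \<le> norm (d t) * (norm (d t) * K)" by (intro mult_left_mono K) auto
    also have "\<dots> = K * (d t \<bullet> d t)" 
      unfolding dot_square_norm power2_eq_square by (simp only: mult_ac)
    finally show ?thesis unfolding h'_def by (intro mult_nonneg_nonpos) simp_all
  qed
  with h' have "h 1 \<le> h 0"
    using DERIV_nonpos_imp_nonincreasing[of 0 1 h] by (meson zero_le_one)
  moreover have "d 0 = 0" by (simp add: d_def g op_exp_zero)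
  ultimately have "d 1 \<bullet> d 1 \<le> 0" unfolding h_def by (simp add: zero_less_mult_iff mult_le_0_iff)
  then have "d 1 = 0" by (metis inner_gt_zero_iff not_less)
  then show ?thesis by (simp add: d_def)
qed

section \<open>Matrix exponentials and congruence\<close>

lemma bounded_bilinear_matrix_mult:
  "bounded_bilinear ((**) :: real^'n^'m \<Rightarrow> real^'p^'n \<Rightarrow> real^'p^'m)"
  unfolding bilinear_conv_bounded_bilinear[symmetric] bilinear_def
  by (auto intro!: linearI simp: matrix_matrix_mult_def vec_eq_iff algebra_simps sum.distrib sum_distrib_left)

lemmas linear_matrix_mult_left =
  bounded_bilinear.bounded_linear_right[OF bounded_bilinear_matrix_mult, THEN bounded_linear.linear]

lemma matrix_exp_eq_op_exp: "matrix_exp A = op_exp ((**) A) (mat 1)"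
  by (simp add: matrix_exp_def op_exp_def)

lemma matrix_exp_zero: "matrix_exp (0 :: real^'n^'n) = mat 1"
proof -
  have "(**) (0 :: real^'n^'n) = (\<lambda>z :: real^'n^'n. 0)" by (auto simp: matrix_matrix_mult_def vec_eq_iff)
  then show ?thesis by (simp add: matrix_exp_eq_op_exp op_exp_zero)
qed

lemma matrix_scaleR_mult: "(t *\<^sub>R A) ** B = t *\<^sub>R (A ** B)" for A :: "real^'n^'m"
  by (rule bounded_bilinear.scaleR_left[OF bounded_bilinear_matrix_mult])

lemma matrix_exp_has_vector_derivative:
  "((\<lambda>t. matrix_exp (t *\<^sub>R A)) has_vector_derivative A ** matrix_exp (t *\<^sub>R A)) (at t)"
proof -
  have *: "(**) (t *\<^sub>R A) = (\<lambda>z. t *\<^sub>R (A ** z))" for t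
    by (auto simp: matrix_scaleR_mult)
  show ?thesis
    unfolding matrix_exp_eq_op_exp *
    by (rule op_exp_has_vector_derivative[OF linear_matrix_mult_left])
qed

lemma bounded_linear_transpose: "bounded_linear (transpose :: real^'n^'m \<Rightarrow> real^'m^'n)"
  unfolding linear_conv_bounded_linear[symmetric]
  by (auto intro!: linearI simp: transpose_def vec_eq_iff)

text \<open>By the product rule the left and right exponential factors contribute the two summands
  of the operator; the solution is then evaluated at time 1.\<close>

lemma op_exp_congruence:
  fixes u y :: "real^'n^'n"
  shows "op_exp (\<lambda>z. u ** z + z ** transpose u) y = matrix_exp u ** y ** transpose (matrix_exp u)"
proof -
  interpret mm: bounded_bilinear "(**) :: real^'n^'n \<Rightarrow> real^'n^'n \<Rightarrow> real^'n^'n"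
    by (rule bounded_bilinear_matrix_mult)
  define E where "E t = matrix_exp (t *\<^sub>R u)" for t
  define g where "g t = E t ** y ** transpose (E t)" for t
  have E': "(E has_vector_derivative u ** E t) (at t)" for t
    unfolding E_def by (rule matrix_exp_has_vector_derivative)
  have "(g has_vector_derivative u ** g t + g t ** transpose u) (at t)" for t
  proof -
    have 1: "((\<lambda>t. E t ** y) has_vector_derivative u ** E t ** y) (at t)"
      using bounded_linear.has_vector_derivative[OF mm.bounded_linear_left E'] .
    have 2: "((\<lambda>t. transpose (E t)) has_vector_derivative transpose (u ** E t)) (at t)"
      using bounded_linear.has_vector_derivative[OF bounded_linear_transpose E'] .
    show ?thesis
      using mm.has_vector_derivative[OF 1 2]
      by (simp add: g_def[abs_def] matrix_transpose_mul matrix_mul_assoc add.commute)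
  qed
  moreover have "linear (\<lambda>z. u ** z + z ** transpose u)"
    by (intro linear_compose_add bounded_linear.linear
        mm.bounded_linear_left mm.bounded_linear_right)
  moreover have "g 0 = y" by (simp add: g_def E_def matrix_exp_zero transpose_mat)
  ultimately have "op_exp (\<lambda>z. u ** z + z ** transpose u) y = g 1"
    by (intro op_exp_ode_unique)
  then show ?thesis by (simp add: g_def E_def)
qed

section \<open>Calculus of continuously differentiable maps\<close>

text \<open>Openness of \<open>U\<close> is essential: the derivative at a point of \<open>U\<close>
  sees a whole neighbourhood, where f and g must agree.\<close>

lemma Ck_on_cong:
  fixes f g :: "'a::euclidean_space \<Rightarrow> 'b::euclidean_space"
  assumes "open U" and "Ck_on k U f" and "\<And>x. x \<in> U \<Longrightarrow> f x = g x"
  shows "Ck_on k U g"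
  using assms(2,3)
proof (induction k arbitrary: f g)
  case 0
  then show ?case using continuous_on_cong[of U U f g] by simp
next
  case (Suc k)
  have D: "(g has_derivative frechet_derivative f (at x)) (at x)" if "x \<in> U" for x
  proof (rule has_derivative_transform_within_open[OF _ assms(1) that])
    show "(f has_derivative frechet_derivative f (at x)) (at x)"
      using Suc.prems(1) that by (simp flip: frechet_derivative_works)
  qed (simp add: Suc.prems(2))
  have "Ck_on k U (\<lambda>x. frechet_derivative g (at x) v)" for v
  proof (rule Suc.IH)
    show "Ck_on k U (\<lambda>x. frechet_derivative f (at x) v)" using Suc.prems(1) by simp
    show "frechet_derivative f (at x) v = frechet_derivative g (at x) v" if "x \<in> U" for x
      using frechet_derivative_at[OF D[OF that]] by simp
  qed
  then show ?case using D by (auto simp: differentiable_def)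
qed

text \<open>Allows an explicit derivative to replace \<open>frechet_derivative\<close>, which agrees
  with it on \<open>U\<close>.\<close>

lemma Ck_onI:
  fixes f :: "'a::euclidean_space \<Rightarrow> 'b::euclidean_space"
  assumes "open U" and D: "\<And>x. x \<in> U \<Longrightarrow> (f has_derivative f' x) (at x)"
    and C: "\<And>v. Ck_on k U (\<lambda>x. f' x v)"
  shows "Ck_on (Suc k) U f"
proof -
  have "Ck_on k U (\<lambda>x. frechet_derivative f (at x) v)" for v
  proof (rule Ck_on_cong[OF assms(1) C])
    show "f' x v = frechet_derivative f (at x) v" if "x \<in> U" for x
      using frechet_derivative_at[OF D[OF that]] by simp
  qed
  then show ?thesis using D by (auto simp: differentiable_def)
qed

lemma Ck_on_has_derivative:
  assumes "Ck_on (Suc k) U f" "x \<in> U"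
  shows "(f has_derivative frechet_derivative f (at x)) (at x)"
  using assms by (simp flip: frechet_derivative_works)

lemma Ck_on_frechet_derivative:
  "Ck_on (Suc k) U f \<Longrightarrow> Ck_on k U (\<lambda>x. frechet_derivative f (at x) v)"
  by simp

text \<open>In the product and chain rules undifferentiated factors survive; their order has to be
  lowered to match that of the derivatives.\<close>

lemma Ck_on_SucD: "Ck_on (Suc k) U f \<Longrightarrow> Ck_on k U f"
proof (induction k arbitrary: f)
  case 0
  then show ?case
    by (auto intro!: continuous_at_imp_continuous_on differentiable_imp_continuous_within)
qed auto

lemma Ck_on_const: "Ck_on k U (\<lambda>x. c)"
proof (induction k arbitrary: c)
  case (Suc k)
  then show ?case by (simp add: frechet_derivative_const)
qed simp

lemma Ck_on_linear:
  assumes "bounded_linear f"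
  shows "Ck_on k U f"
proof (cases k)
  case 0
  then show ?thesis by (simp add: linear_continuous_on assms)
next
  case (Suc j)
  have D: "(f has_derivative f) (at x)" for x
    using assms by (rule bounded_linear_imp_has_derivative)
  then have "frechet_derivative f (at x) = f" for x
    by (metis frechet_derivative_at)
  then show ?thesis
    unfolding Suc Ck_on.simps differentiable_def using D by (auto simp: Ck_on_const)
qed

lemma Ck_on_add:
  assumes "open U" "Ck_on k U f" "Ck_on k U g"
  shows "Ck_on k U (\<lambda>x. f x + g x)"
  using assms(2,3)
proof (induction k arbitrary: f g)
  case 0
  then show ?case by (simp add: continuous_on_add)
next
  case (Suc k)
  note D = Ck_on_has_derivative[OF Suc.prems(1)] Ck_on_has_derivative[OF Suc.prems(2)]
  show ?case
    by (rule Ck_onI[OF assms(1) has_derivative_add[OF D]])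
      (use Suc.prems in \<open>auto intro: Suc.IH\<close>)
qed

text \<open>Each summand of the product rule pairs a derivative with an undifferentiated factor, so
  the induction must range over both maps. It covers real products as well as scaling of
  vectors.\<close>

lemma Ck_on_bilinear:
  assumes "bounded_bilinear p" "open U" "Ck_on k U f" "Ck_on k U g"
  shows "Ck_on k U (\<lambda>x. p (f x) (g x))"
  using assms(3,4)
proof (induction k arbitrary: f g)
  case 0
  then show ?case by (simp add: bounded_bilinear.continuous_on[OF assms(1)])
next
  case (Suc k)
  note D = Ck_on_has_derivative[OF Suc.prems(1)] Ck_on_has_derivative[OF Suc.prems(2)]
  show ?case
  proof (rule Ck_onI[OF assms(2) bounded_bilinear.FDERIV[OF assms(1) D]])
    fix v
    let ?df = "\<lambda>x. frechet_derivative f (at x) v" and ?dg = "\<lambda>x. frechet_derivative g (at x) v"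
    have "Ck_on k U (\<lambda>x. p (f x) (?dg x))" "Ck_on k U (\<lambda>x. p (?df x) (g x))"
      using Suc.IH[OF Ck_on_SucD[OF Suc.prems(1)] Ck_on_frechet_derivative[OF Suc.prems(2)]]
        Suc.IH[OF Ck_on_frechet_derivative[OF Suc.prems(1)] Ck_on_SucD[OF Suc.prems(2)]]
      by blast+
    then show "Ck_on k U (\<lambda>x. p (f x) (?dg x) + p (?df x) (g x))"
      by (rule Ck_on_add[OF assms(2)])
  qed
qed

lemmas Ck_on_mult = Ck_on_bilinear[OF bounded_bilinear_mult]

lemma Ck_on_diff:
  assumes "open U" "Ck_on k U f" "Ck_on k U g"
  shows "Ck_on k U (\<lambda>x. f x - g x)"
proof -
  have "Ck_on k U (\<lambda>x. (-1) *\<^sub>R g x)"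
    by (intro Ck_on_bilinear[OF bounded_bilinear_scaleR] assms Ck_on_const)
  from Ck_on_add[OF assms(1,2) this] show ?thesis by simp
qed

text \<open>For a real argument the derivative of h is multiplication by a number, so the chain rule
  gives a product. The induction generalises h because its derivative takes its place.\<close>

lemma Ck_on_compose:
  fixes h :: "real \<Rightarrow> real"
  assumes "open U" "open I" "Ck_on k I h" "Ck_on k U f" "f ` U \<subseteq> I"
  shows "Ck_on k U (\<lambda>x. h (f x))"
  using assms(3-)
proof (induction k arbitrary: h f)
  case 0
  then show ?case by (auto intro: continuous_on_compose2)
next
  case (Suc k)
  define h' where "h' s = frechet_derivative h (at s) 1" for s
  show ?case
  proof (rule Ck_onI[OF assms(1)])
    fix x assume x: "x \<in> U"
    have h: "(h has_derivative frechet_derivative h (at (f x))) (at (f x))"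
      using Ck_on_has_derivative[OF Suc.prems(1)] Suc.prems(3) x by blast
    have "frechet_derivative h (at (f x)) w = h' (f x) * w" for w
      using linear_scale[OF has_derivative_linear[OF h], of w 1] by (simp add: h'_def)
    then show "((\<lambda>x. h (f x)) has_derivative (\<lambda>v. h' (f x) * frechet_derivative f (at x) v)) (at x)"
      using has_derivative_compose[OF Ck_on_has_derivative[OF Suc.prems(2) x] h] by simp
  next
    have "Ck_on k I h'" unfolding h'_def by (rule Ck_on_frechet_derivative[OF Suc.prems(1)])
    then show "Ck_on k U (\<lambda>x. h' (f x) * frechet_derivative f (at x) v)" for v
      by (rule Ck_on_mult[OF assms(1) Suc.IH[OF _ Ck_on_SucD[OF Suc.prems(2)] Suc.prems(3)]
          Ck_on_frechet_derivative[OF Suc.prems(2)]])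
  qed
qed

text \<open>The basis expansion is built up one basis vector at a time, since
  \<open>Ck_on_add\<close> handles two summands.\<close>

lemma Ck_on_componentwise:
  fixes f :: "'a::euclidean_space \<Rightarrow> 'b::euclidean_space"
  assumes "open U" "\<And>i. i \<in> Basis \<Longrightarrow> Ck_on k U (\<lambda>x. f x \<bullet> i)"
  shows "Ck_on k U f"
proof -
  have "Ck_on k U (\<lambda>x. \<Sum>i\<in>B. (f x \<bullet> i) *\<^sub>R i)" if "B \<subseteq> Basis" for B :: "'b set"
    using finite_subset[OF that finite_Basis] that
  proof (induction B rule: finite_induct)
    case (insert i B)
    then have "Ck_on k U (\<lambda>x. (f x \<bullet> i) *\<^sub>R i + (\<Sum>i\<in>B. (f x \<bullet> i) *\<^sub>R i))"
      by (intro Ck_on_add[OF assms(1)] Ck_on_bilinear[OF bounded_bilinear_scaleR assms(1)]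
          Ck_on_const assms(2)) auto
    then show ?case by (simp only: sum.insert[OF insert.hyps])
  qed (simp add: Ck_on_const)
  from this[OF order.refl] show ?thesis by (simp add: euclidean_representation)
qed

lemma Ck_on_matrix:
  fixes f :: "'a::euclidean_space \<Rightarrow> real^'n^'m"
  assumes "open U" "\<And>i j. Ck_on k U (\<lambda>x. f x $ i $ j)"
  shows "Ck_on k U f"
proof (rule Ck_on_componentwise[OF assms(1)])
  fix b :: "real^'n^'m"
  assume "b \<in> Basis"
  then obtain i j where "b = axis i (axis j 1)" by (auto simp: Basis_vec_def)
  then have "f x \<bullet> b = f x $ i $ j" for x by (simp add: inner_axis)
  then show "Ck_on k U (\<lambda>x. f x \<bullet> b)" using assms(2)[of i j] by simp
qed

lemma Ck_on_entry: "Ck_on k U (\<lambda>x :: real^'n^'m. x $ i $ j)"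
  by (rule Ck_on_linear[OF bounded_linear_compose[OF bounded_linear_vec_nth bounded_linear_vec_nth]])

section \<open>Smooth functions of one real variable\<close>

lemma Ck_on_real_derivative:
  fixes f :: "real \<Rightarrow> real"
  assumes "open U" "\<And>x. x \<in> U \<Longrightarrow> (f has_real_derivative f' x) (at x)" "Ck_on k U f'"
  shows "Ck_on (Suc k) U f"
proof (rule Ck_onI[OF assms(1)])
  show "(f has_derivative (*) (f' x)) (at x)" if "x \<in> U" for x
    using assms(2)[OF that] by (simp add: has_field_derivative_def)
  show "Ck_on k U (\<lambda>x. f' x * v)" for v
    by (rule Ck_on_mult[OF assms(1,3) Ck_on_const])
qed

lemma Ck_on_exp: "Ck_on k UNIV (exp :: real \<Rightarrow> real)"
proof (induction k)
  case (Suc k)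
  show ?case by (rule Ck_on_real_derivative[OF open_UNIV DERIV_exp Suc])
qed (simp add: continuous_on_exp)

text \<open>The derivative is a polynomial in \<open>inverse\<close> itself, so the induction
  closes.\<close>

lemma Ck_on_inverse: "Ck_on k {0<..} (inverse :: real \<Rightarrow> real)"
proof (induction k)
  case (Suc k)
  show ?case
  proof (rule Ck_on_real_derivative)
    show "(inverse has_real_derivative - 1 * (inverse x * inverse x)) (at x)" if "x \<in> {0<..}" for x :: real
      using that DERIV_inverse[of x] by (simp add: power2_eq_square)
    show "Ck_on k {0<..} (\<lambda>x::real. - 1 * (inverse x * inverse x))"
      by (rule Ck_on_mult[OF _ Ck_on_const Ck_on_mult[OF _ Suc Suc]]) auto
  qed simp
qed (simp add: continuous_on_inverse)

lemma Ck_on_ln: "Ck_on k {0<..} (ln :: real \<Rightarrow> real)"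
proof (cases k)
  case (Suc j)
  show ?thesis
    unfolding Suc by (rule Ck_on_real_derivative[OF _ _ Ck_on_inverse]) (auto intro: DERIV_ln)
qed (auto intro!: continuous_on_ln)

text \<open>Everywhere convergent power series are closed under differentiation, with
  \<open>diffs c\<close> as the new coefficients.\<close>

lemma Ck_on_powser:
  fixes c :: "nat \<Rightarrow> real"
  assumes "\<And>x. summable (\<lambda>n. c n * x ^ n)"
  shows "Ck_on k UNIV (\<lambda>x. \<Sum>n. c n * x ^ n)"
  using assms
proof (induction k arbitrary: c)
  case 0
  have "((\<lambda>x. \<Sum>n. c n * x ^ n) has_real_derivative (\<Sum>n. diffs c n * x ^ n)) (at x)" for x
    using 0 by (rule termdiffs_strong_converges_everywhere)
  then show ?case
    by (auto intro!: continuous_at_imp_continuous_on DERIV_isCont)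
next
  case (Suc k)
  show ?case
  proof (rule Ck_on_real_derivative)
    show "((\<lambda>x. \<Sum>n. c n * x ^ n) has_real_derivative (\<Sum>n. diffs c n * x ^ n)) (at x)" for x
      using Suc.prems by (rule termdiffs_strong_converges_everywhere)
    show "Ck_on k UNIV (\<lambda>x. \<Sum>n. diffs c n * x ^ n)"
      using Suc.prems by (intro Suc.IH termdiff_converges_all)
  qed auto
qed

section \<open>The function (exp s - 1) / s\<close>

definition exp_quot :: "real \<Rightarrow> real" where
  "exp_quot s = (if s = 0 then 1 else (exp s - 1) / s)"

lemma exp_quot_pos: "exp_quot s > 0"
  by (auto simp: exp_quot_def zero_less_divide_iff)

text \<open>Dropping the constant term of the exponential series and dividing by s shifts the index,
  hence the factorial of \<open>Suc n\<close>. The value 1 at 0 is the constant term of the new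
  series.\<close>

lemma exp_quot_sums: "(\<lambda>n. inverse (fact (Suc n)) * s ^ n) sums exp_quot s"
proof (cases "s = 0")
  case True
  then show ?thesis
    using powser_sums_zero[of "\<lambda>n. inverse (fact (Suc n))"] by (simp add: exp_quot_def)
next
  case False
  have *: "(\<lambda>n. s ^ Suc n /\<^sub>R fact (Suc n)) sums (exp s - 1)"
    using sums_Suc_iff[of "\<lambda>n. s ^ n /\<^sub>R fact n"] exp_converges[of s] by simp
  have 1: "inverse s * (s ^ Suc n /\<^sub>R fact (Suc n)) = inverse (fact (Suc n)) * s ^ n" for n
    using False by simp
  have 2: "inverse s * (exp s - 1) = exp_quot s"
    using False by (simp add: exp_quot_def divide_inverse_commute)
  show ?thesis
    using sums_mult[OF *, of "inverse s"] unfolding 1 2 .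
qed

text \<open>Smoothness at 0 cannot be read off the case distinction; the power series gives it at
  all points at once.\<close>

lemma Ck_on_exp_quot: "Ck_on k UNIV exp_quot"
proof -
  have "exp_quot = (\<lambda>s. \<Sum>n. inverse (fact (Suc n)) * s ^ n)"
    using exp_quot_sums by (auto simp: sums_iff)
  moreover have "Ck_on k UNIV (\<lambda>s::real. \<Sum>n. inverse (fact (Suc n)) * s ^ n)"
    by (intro Ck_on_powser sums_summable[OF exp_quot_sums])
  ultimately show ?thesis by simp
qed

section \<open>Explicit formulas for the clan exponential and logarithm\<close>

text \<open>Five real coordinates, the diagonal first and then the last row, reduce matrix
  identities in h to scalar ones.\<close>

definition low :: "real \<Rightarrow> real \<Rightarrow> real \<Rightarrow> real \<Rightarrow> real \<Rightarrow> real^3^3" where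
  "low a b c p q = vector [vector [a, 0, 0], vector [0, b, 0], vector [p, q, c]]"

definition sym3 :: "real \<Rightarrow> real \<Rightarrow> real \<Rightarrow> real \<Rightarrow> real \<Rightarrow> real^3^3" where
  "sym3 a b c p q = vector [vector [a, 0, p], vector [0, b, q], vector [p, q, c]]"

lemma low_nth [simp]:
  "low a b c p q $ 1 $ 1 = a" "low a b c p q $ 1 $ 2 = 0" "low a b c p q $ 1 $ 3 = 0"
  "low a b c p q $ 2 $ 1 = 0" "low a b c p q $ 2 $ 2 = b" "low a b c p q $ 2 $ 3 = 0"
  "low a b c p q $ 3 $ 1 = p" "low a b c p q $ 3 $ 2 = q" "low a b c p q $ 3 $ 3 = c"
  by (simp_all add: low_def)

lemma sym3_nth [simp]:
  "sym3 a b c p q $ 1 $ 1 = a" "sym3 a b c p q $ 1 $ 2 = 0" "sym3 a b c p q $ 1 $ 3 = p"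
  "sym3 a b c p q $ 2 $ 1 = 0" "sym3 a b c p q $ 2 $ 2 = b" "sym3 a b c p q $ 2 $ 3 = q"
  "sym3 a b c p q $ 3 $ 1 = p" "sym3 a b c p q $ 3 $ 2 = q" "sym3 a b c p q $ 3 $ 3 = c"
  by (simp_all add: sym3_def)

lemma low_in_clan_h: "low a b c p q \<in> clan_h"
  by (simp add: clan_h_def)

lemma low_in_clan_H_iff: "low a b c p q \<in> clan_H \<longleftrightarrow> a > 0 \<and> b > 0 \<and> c > 0"
  by (simp add: clan_H_def low_in_clan_h forall_3)

lemma clan_h_cases:
  assumes "T \<in> clan_h"
  obtains a b c p q where "T = low a b c p q"
proof
  show "T = low (T$1$1) (T$2$2) (T$3$3) (T$3$1) (T$3$2)"
    using assms by (simp add: clan_h_def vec_eq_iff forall_3)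
qed

lemma sym3_in_clan_V: "sym3 a b c p q \<in> clan_V"
  by (simp add: clan_V_def vec_eq_iff forall_3 transpose_def)

lemma clan_V_cases:
  assumes "x \<in> clan_V"
  obtains a b c p q where "x = sym3 a b c p q"
proof
  have "x$1$2 = 0" "x$2$1 = 0" "x$1$3 = x$3$1" "x$2$3 = x$3$2"
    using assms by (auto simp: clan_V_def transpose_def vec_eq_iff)
  then show "x = sym3 (x$1$1) (x$2$2) (x$3$3) (x$3$1) (x$3$2)"
    by (simp add: vec_eq_iff forall_3)
qed

lemma low_mult:
  "low a b c p q ** low a' b' c' p' q' =
    low (a * a') (b * b') (c * c') (p * a' + c * p') (q * b' + c * q')"
  by (simp add: vec_eq_iff forall_3 matrix_matrix_mult_def sum_3)

lemma low_add_transpose: "low a b c p q + transpose (low a b c p q) = sym3 (2 * a) (2 * b) (2 * c) p q"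
  by (simp add: vec_eq_iff forall_3 transpose_def)

lemma clan_Phi_low:
  "clan_Phi (low a b c p q) = sym3 (a\<^sup>2) (b\<^sup>2) (p\<^sup>2 + q\<^sup>2 + c\<^sup>2) (a * p) (b * q)"
  by (simp add: clan_Phi_def vec_eq_iff forall_3 matrix_matrix_mult_def transpose_def sum_3
      power2_eq_square)

text \<open>Fixed matrices with scalar coefficients, so that a curve in h can be differentiated
  coordinate by coordinate.\<close>

lemma low_eq_sum:
  "low a b c p q = a *\<^sub>R low 1 0 0 0 0 + b *\<^sub>R low 0 1 0 0 0 + c *\<^sub>R low 0 0 1 0 0 +
    p *\<^sub>R low 0 0 0 1 0 + q *\<^sub>R low 0 0 0 0 1"
  by (simp add: vec_eq_iff forall_3)

lemma low_has_vector_derivative: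
  assumes "(a has_real_derivative a') (at t)" "(b has_real_derivative b') (at t)"
    "(c has_real_derivative c') (at t)" "(p has_real_derivative p') (at t)"
    "(q has_real_derivative q') (at t)"
  shows "((\<lambda>t. low (a t) (b t) (c t) (p t) (q t)) has_vector_derivative low a' b' c' p' q') (at t)"
proof -
  have scale: "((\<lambda>t. f t *\<^sub>R M) has_vector_derivative f' *\<^sub>R M) (at t)"
    if "(f has_real_derivative f') (at t)" for f f' and M :: "real^3^3"
    using has_vector_derivative_scaleR[OF that has_vector_derivative_const[of M]] by simp
  show ?thesis
    unfolding low_eq_sum[of "a _"] low_eq_sum[of a']
    by (rule has_vector_derivative_add scale assms)+
qed

text \<open>The function is the integral of exp (s d) over s from 0 to t, for d = 0 as well.\<close>

lemma has_real_derivative_exp_quot: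
  "((\<lambda>t. t * exp_quot (t * d)) has_real_derivative exp (t * d)) (at t)"
proof (cases "d = 0")
  case False
  then have "(\<lambda>t. t * exp_quot (t * d)) = (\<lambda>t. (exp (t * d) - 1) / d)"
    by (auto simp: exp_quot_def)
  then show ?thesis using False by (auto intro!: derivative_eq_intros)
qed (simp add: exp_quot_def)

lemma matrix_exp_low:
  "matrix_exp (low a b c p q) =
    low (exp a) (exp b) (exp c) (p * exp c * exp_quot (a - c)) (q * exp c * exp_quot (b - c))"
proof -
  \<comment> \<open>Variation of constants: r G d solves f' = r exp (t d) + c f with f 0 = 0, the
    equation of an off-diagonal entry.\<close>
  define G where "G d t = exp (t * c) * (t * exp_quot (t * (d - c)))" for d t
  have G': "((\<lambda>t. r * G d t) has_real_derivative (r * exp (t * d) + c * (r * G d t))) (at t)" for r d t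
  proof -
    have "((\<lambda>t. exp (t * c)) has_real_derivative exp (t * c) * c) (at t)"
      by (auto intro!: derivative_eq_intros)
    from DERIV_cmult[OF DERIV_mult[OF this has_real_derivative_exp_quot], of r "d - c"]
    show ?thesis
      by (simp add: G_def algebra_simps flip: exp_add)
  qed
  define g where "g t = low (exp (t * a)) (exp (t * b)) (exp (t * c)) (p * G a t) (q * G b t)" for t
  have E: "((\<lambda>t. exp (t * d)) has_real_derivative d * exp (t * d)) (at t)" for d t :: real
    by (auto intro!: derivative_eq_intros)
  have "(g has_vector_derivative low a b c p q ** g t) (at t)" for t
    unfolding g_def low_mult by (intro low_has_vector_derivative E G')
  moreover have "g 0 = mat 1"
    by (simp add: g_def G_def vec_eq_iff forall_3 mat_def)
  ultimately have "matrix_exp (low a b c p q) = g 1"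
    unfolding matrix_exp_eq_op_exp by (rule op_exp_ode_unique[OF linear_matrix_mult_left])
  then show ?thesis by (simp add: g_def G_def mult.assoc)
qed

lemma lower_part_sym3: "lower_part (sym3 a b c p q) = low (a / 2) (b / 2) (c / 2) p q"
  unfolding lower_part_def
  by (rule the1_equality[OF lower_part_unique[OF sym3_in_clan_V]])
    (simp add: low_in_clan_h low_add_transpose)

lemma clan_Exp_eq: "clan_Exp x = clan_Phi (matrix_exp (lower_part x))"
proof -
  have "clan_L x = (\<lambda>z. lower_part x ** z + z ** transpose (lower_part x))"
    by (auto simp: clan_L_def clan_prod_def)
  then show ?thesis
    by (simp add: clan_Exp_def op_exp_congruence clan_Phi_def)
qed

lemma exp_quot_nonzero: "exp_quot s \<noteq> 0"
  using exp_quot_pos[of s] by simp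

text \<open>The Schur complement of the upper left block, which is the square of the last diagonal
  entry of the Cholesky factor.\<close>

definition schur33 :: "real^3^3 \<Rightarrow> real" where
  "schur33 y = y$3$3 - y$3$1 * y$3$1 * inverse (y$1$1) - y$3$2 * y$3$2 * inverse (y$2$2)"

text \<open>P and Q form the off-diagonal last row of \<open>matrix_exp (lower_part x)\<close>, and
  the result is \<open>clan_Phi\<close> of that matrix. Using entries only, the formula extends
  smoothly from V to all matrices.\<close>

definition exp_coords :: "real^3^3 \<Rightarrow> real^3^3" where
  "exp_coords x =
    (let P = x$3$1 * exp (x$3$3 / 2) * exp_quot (x$1$1 / 2 - x$3$3 / 2);
         Q = x$3$2 * exp (x$3$3 / 2) * exp_quot (x$2$2 / 2 - x$3$3 / 2)
     in sym3 (exp (x$1$1)) (exp (x$2$2)) (P * P + Q * Q + exp (x$3$3))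
          (exp (x$1$1 / 2) * P) (exp (x$2$2 / 2) * Q))"

text \<open>The two upper diagonal entries and the Schur complement are the squared diagonal of the
  Cholesky factor; their logarithms are twice the diagonal of its logarithm. The remaining entries
  undo the factors applied in \<open>exp_coords\<close>.\<close>

definition log_coords :: "real^3^3 \<Rightarrow> real^3^3" where
  "log_coords y =
    (let a = ln (y$1$1); b = ln (y$2$2); c = ln (schur33 y)
     in sym3 a b c
          (y$3$1 * inverse (exp (a / 2) * exp (c / 2) * exp_quot (a / 2 - c / 2)))
          (y$3$2 * inverse (exp (b / 2) * exp (c / 2) * exp_quot (b / 2 - c / 2))))"

lemma exp_half_squared: "(exp (x / 2))\<^sup>2 = exp x" for x :: real
  by (simp flip: exp_double)

lemma clan_Exp_coords: "x \<in> clan_V \<Longrightarrow> clan_Exp x = exp_coords x"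
  by (elim clan_V_cases)
    (simp add: clan_Exp_eq lower_part_sym3 matrix_exp_low clan_Phi_low exp_half_squared
      exp_coords_def Let_def flip: power2_eq_square)

text \<open>Completing the squares in the first two coordinates leaves the Schur complement as the
  coefficient of the third.\<close>

lemma sym3_quadratic_form:
  assumes "a \<noteq> 0" "b \<noteq> 0"
  shows "v \<bullet> (sym3 a b c p q *v v) =
    a * (v$1 + p * v$3 / a)\<^sup>2 + b * (v$2 + q * v$3 / b)\<^sup>2 + schur33 (sym3 a b c p q) * (v$3)\<^sup>2"
  using assms
  by (simp add: inner_vec_def matrix_vector_mult_def sum_3 schur33_def field_simps power2_eq_square)

lemma clan_Omega_iff:
  "x \<in> clan_Omega \<longleftrightarrow> x \<in> clan_V \<and> x$1$1 > 0 \<and> x$2$2 > 0 \<and> schur33 x > 0"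
proof (intro iffI conjI)
  assume "x \<in> clan_Omega"
  then have V: "x \<in> clan_V" and pos: "\<And>v. v \<noteq> 0 \<Longrightarrow> v \<bullet> (x *v v) > 0"
    by (auto simp: clan_Omega_def)
  show "x \<in> clan_V" by fact
  obtain a b c p q where x: "x = sym3 a b c p q" using V by (rule clan_V_cases)
  show 1: "x$1$1 > 0"
    using pos[of "vector [1, 0, 0]"]
    by (simp add: x vec_eq_iff forall_3 inner_vec_def matrix_vector_mult_def sum_3)
  show 2: "x$2$2 > 0"
    using pos[of "vector [0, 1, 0]"]
    by (simp add: x vec_eq_iff forall_3 inner_vec_def matrix_vector_mult_def sum_3)
  \<comment> \<open>The test vector makes both completed squares vanish, leaving only the Schur
    complement.\<close>
  show "schur33 x > 0"
    using pos[of "vector [- p / a, - q / b, 1]"] sym3_quadratic_form[of a b "vector [- p / a, - q / b, 1]" c p q] 1 2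
    by (simp add: x vec_eq_iff forall_3)
next
  assume *: "x \<in> clan_V \<and> x$1$1 > 0 \<and> x$2$2 > 0 \<and> schur33 x > 0"
  then obtain a b c p q where x: "x = sym3 a b c p q" using clan_V_cases by blast
  have "v \<bullet> (x *v v) > 0" if "v \<noteq> 0" for v
  proof -
    have ab: "a > 0" "b > 0" and s: "schur33 x > 0" using * by (auto simp: x)
    have nn: "a * (v$1 + p * v$3 / a)\<^sup>2 \<ge> 0" "b * (v$2 + q * v$3 / b)\<^sup>2 \<ge> 0" "schur33 x * (v$3)\<^sup>2 \<ge> 0"
      using ab s by simp_all
    \<comment> \<open>If the third coordinate is nonzero, the last term is positive; otherwise the
      squares reduce to those of the first two coordinates, not both zero.\<close>
    have "a * (v$1 + p * v$3 / a)\<^sup>2 > 0 \<or> b * (v$2 + q * v$3 / b)\<^sup>2 > 0 \<or> schur33 x * (v$3)\<^sup>2 > 0"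
      using that ab s by (cases "v$3 = 0") (auto simp: vec_eq_iff forall_3)
    with nn show ?thesis
      using sym3_quadratic_form[of a b v c p q] ab unfolding x by linarith
  qed
  then show "x \<in> clan_Omega" using * by (simp add: clan_Omega_def)
qed

text \<open>Dividing the squared off-diagonal entries by the diagonal ones gives back P * P and Q *
  Q, which cancel in the last diagonal entry.\<close>

lemma schur33_exp_coords: "schur33 (exp_coords x) = exp (x$3$3)"
proof -
  have *: "(exp (r / 2) * P) * (exp (r / 2) * P) * inverse (exp r) = P * P" for P r :: real
  proof -
    have "exp (r / 2) * exp (r / 2) = exp r" by (simp flip: exp_add)
    then have "(exp (r / 2) * P) * (exp (r / 2) * P) = P * P * exp r" by (simp add: mult_ac)
    then show ?thesis by (simp add: field_simps)
  qed
  show ?thesis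
    unfolding schur33_def exp_coords_def Let_def sym3_nth * by simp
qed

lemma exp_coords_in_clan_Omega: "exp_coords x \<in> clan_Omega"
  unfolding clan_Omega_iff schur33_exp_coords
  by (simp add: exp_coords_def Let_def sym3_in_clan_V)

lemma log_coords_in_clan_V: "log_coords y \<in> clan_V"
  by (simp add: log_coords_def Let_def sym3_in_clan_V)

lemma log_exp_coords:
  assumes "x \<in> clan_V"
  shows "log_coords (exp_coords x) = x"
proof -
  obtain a b c p q where x: "x = sym3 a b c p q" using assms by (rule clan_V_cases)
  have cancel: "e * (r * f * g) * inverse (e * f * g) = r" if "e \<noteq> 0" "f \<noteq> 0" "g \<noteq> 0" for e f g r :: real
    using that by (simp add: field_simps)
  have "log_coords (exp_coords x) = sym3 a b c
      (exp (a / 2) * (p * exp (c / 2) * exp_quot (a / 2 - c / 2)) *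
        inverse (exp (a / 2) * exp (c / 2) * exp_quot (a / 2 - c / 2)))
      (exp (b / 2) * (q * exp (c / 2) * exp_quot (b / 2 - c / 2)) *
        inverse (exp (b / 2) * exp (c / 2) * exp_quot (b / 2 - c / 2)))"
    \<comment> \<open>The Schur complement is evaluated as a whole before \<open>exp_coords\<close>
      is unfolded.\<close>
    unfolding log_coords_def schur33_exp_coords Let_def
    unfolding exp_coords_def Let_def x sym3_nth ln_exp ..
  then show ?thesis by (simp only: cancel exp_not_eq_zero exp_quot_nonzero not_False_eq_True x)
qed

lemma exp_log_coords:
  assumes "y \<in> clan_Omega"
  shows "exp_coords (log_coords y) = y"
proof -
  obtain a b c p q where y: "y = sym3 a b c p q"
    using assms by (auto simp: clan_Omega_iff elim: clan_V_cases)
  define d where "d = schur33 y"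
  have c: "c = p * p * inverse a + q * q * inverse b + d" by (simp add: schur33_def d_def y)
  have pos: "a > 0" "b > 0" "d > 0" using assms by (auto simp: clan_Omega_iff y d_def)
  \<comment> \<open>P and Q are the off-diagonal entries of the Cholesky factor of y: exp (ln a / 2)
    is the square root of a.\<close>
  define P where "P = p * inverse (exp (ln a / 2))"
  define Q where "Q = q * inverse (exp (ln b / 2))"
  have cancel: "r * inverse (e * f * g) * f * g = r * inverse e" if "f \<noteq> 0" "g \<noteq> 0" for e f g r :: real
    using that by (simp add: field_simps)
  have "log_coords y = sym3 (ln a) (ln b) (ln d)
      (p * inverse (exp (ln a / 2) * exp (ln d / 2) * exp_quot (ln a / 2 - ln d / 2)))
      (q * inverse (exp (ln b / 2) * exp (ln d / 2) * exp_quot (ln b / 2 - ln d / 2)))"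
    unfolding log_coords_def Let_def d_def[symmetric] by (simp only: y sym3_nth)
  then have "exp_coords (log_coords y) = sym3 (exp (ln a)) (exp (ln b)) (P * P + Q * Q + exp (ln d))
      (exp (ln a / 2) * P) (exp (ln b / 2) * Q)"
    unfolding exp_coords_def Let_def P_def Q_def
    by (simp only: cancel exp_not_eq_zero exp_quot_nonzero not_False_eq_True sym3_nth)
  moreover have "P * P = p * p * inverse a" "Q * Q = q * q * inverse b"
  proof -
    have "r * inverse (exp (ln s / 2)) * (r * inverse (exp (ln s / 2))) = r * r * inverse s"
      if "s > 0" for r s :: real
    proof -
      have "inverse (exp (ln s / 2)) * inverse (exp (ln s / 2)) = inverse s"
        using that exp_half_squared[of "ln s"] by (simp add: power2_eq_square flip: inverse_mult_distrib)
      then show ?thesis by (simp add: mult_ac)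
    qed
    then show "P * P = p * p * inverse a" "Q * Q = q * q * inverse b"
      using pos by (simp_all only: P_def Q_def)
  qed
  moreover have "exp (ln a / 2) * P = p" "exp (ln b / 2) * Q = q"
    by (simp_all add: P_def Q_def)
  ultimately show ?thesis using pos by (simp only: exp_ln y c)
qed

text \<open>The factor is recovered in order: the first two diagonal entries by positive square
  roots, then the last row, then the last diagonal entry. This gives \<open>cholesky\<close> its
  meaning on the image of \<open>clan_Phi\<close>.\<close>

lemma clan_Phi_inj: "inj_on clan_Phi clan_H"
proof (rule inj_onI)
  fix S T assume "S \<in> clan_H" "T \<in> clan_H" and eq: "clan_Phi S = clan_Phi T"
  then have "S \<in> clan_h" "T \<in> clan_h" by (simp_all add: clan_H_def)
  obtain a b c p q where S: "S = low a b c p q" using \<open>S \<in> clan_h\<close> by (rule clan_h_cases)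
  obtain a' b' c' p' q' where T: "T = low a' b' c' p' q'" using \<open>T \<in> clan_h\<close> by (rule clan_h_cases)
  have pos: "a > 0" "b > 0" "c > 0" "a' > 0" "b' > 0" "c' > 0"
    using \<open>S \<in> clan_H\<close> \<open>T \<in> clan_H\<close> by (auto simp: S T low_in_clan_H_iff)
  have e: "sym3 (a\<^sup>2) (b\<^sup>2) (p\<^sup>2 + q\<^sup>2 + c\<^sup>2) (a * p) (b * q) =
      sym3 (a'\<^sup>2) (b'\<^sup>2) (p'\<^sup>2 + q'\<^sup>2 + c'\<^sup>2) (a' * p') (b' * q')"
    using eq by (simp add: S T clan_Phi_low)
  have "a = a'" "b = b'"
    using arg_cong[OF e, of "\<lambda>x. x$1$1"] arg_cong[OF e, of "\<lambda>x. x$2$2"] pos by simp_all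
  moreover from this have "p = p'" "q = q'"
    using arg_cong[OF e, of "\<lambda>x. x$3$1"] arg_cong[OF e, of "\<lambda>x. x$3$2"] pos by simp_all
  moreover from this have "c = c'"
    using arg_cong[OF e, of "\<lambda>x. x$3$3"] pos by simp
  ultimately show "S = T" by (simp add: S T)
qed

lemma cholesky_clan_Phi: "T \<in> clan_H \<Longrightarrow> cholesky (clan_Phi T) = T"
  by (simp add: cholesky_def the_inv_into_f_f clan_Phi_inj)

lemma matrix_exp_lower_part_in_clan_H:
  assumes "x \<in> clan_V"
  shows "matrix_exp (lower_part x) \<in> clan_H"
  using assms by (elim clan_V_cases) (simp add: lower_part_sym3 matrix_exp_low low_in_clan_H_iff)

lemma clan_Exp_inj: "inj_on clan_Exp clan_V"
  by (rule inj_on_inverseI[where g = log_coords]) (simp add: clan_Exp_coords log_exp_coords)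

lemma clan_Log_coords:
  assumes "y \<in> clan_Omega"
  shows "clan_Log y = log_coords y"
  using the_inv_into_f_f[OF clan_Exp_inj log_coords_in_clan_V[of y]] exp_log_coords[OF assms]
  by (simp add: clan_Log_def clan_Exp_coords log_coords_in_clan_V)

section \<open>Smoothness\<close>

lemma Ck_on_sym3:
  assumes "open U" "Ck_on k U a" "Ck_on k U b" "Ck_on k U c" "Ck_on k U p" "Ck_on k U q"
  shows "Ck_on k U (\<lambda>x. sym3 (a x) (b x) (c x) (p x) (q x))"
proof (rule Ck_on_matrix[OF assms(1)])
  have "\<forall>i j. Ck_on k U (\<lambda>x. sym3 (a x) (b x) (c x) (p x) (q x) $ i $ j)"
    by (simp add: forall_3 assms Ck_on_const)
  then show "Ck_on k U (\<lambda>x. sym3 (a x) (b x) (c x) (p x) (q x) $ i $ j)" for i j by blast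
qed

lemma Ck_on_half: "open U \<Longrightarrow> Ck_on k U f \<Longrightarrow> Ck_on k U (\<lambda>x. f x / 2 :: real)"
  using Ck_on_mult[of U k f "\<lambda>x. 1 / 2"] by (simp add: Ck_on_const)

lemma Ck_on_exp_compose: "open U \<Longrightarrow> Ck_on k U f \<Longrightarrow> Ck_on k U (\<lambda>x. exp (f x) :: real)"
  by (rule Ck_on_compose[OF _ open_UNIV Ck_on_exp]) auto

lemma Ck_on_exp_quot_compose: "open U \<Longrightarrow> Ck_on k U f \<Longrightarrow> Ck_on k U (\<lambda>x. exp_quot (f x))"
  by (rule Ck_on_compose[OF _ open_UNIV Ck_on_exp_quot]) auto

lemma Ck_on_inverse_compose:
  assumes "open U" "Ck_on k U f" "\<And>x. x \<in> U \<Longrightarrow> f x > 0"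
  shows "Ck_on k U (\<lambda>x. inverse (f x) :: real)"
  using assms(3) by (intro Ck_on_compose[OF assms(1) _ Ck_on_inverse assms(2)]) auto

lemma Ck_on_ln_compose:
  assumes "open U" "Ck_on k U f" "\<And>x. x \<in> U \<Longrightarrow> f x > 0"
  shows "Ck_on k U (\<lambda>x. ln (f x) :: real)"
  using assms(3) by (intro Ck_on_compose[OF assms(1) _ Ck_on_ln assms(2)]) auto

lemmas Ck_on_rules = Ck_on_exp_compose Ck_on_exp_quot_compose Ck_on_half Ck_on_diff Ck_on_add
  Ck_on_mult Ck_on_sym3

lemma Ck_on_exp_coords: "Ck_on k UNIV exp_coords"
  unfolding exp_coords_def[abs_def] Let_def
  by (rule Ck_on_entry Ck_on_rules open_UNIV)+

text \<open>Omega is not open among all matrices, whereas this set is; it meets V exactly in Omega,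
  so it carries the smooth extension of the clan logarithm.\<close>

definition log_domain :: "(real^3^3) set" where
  "log_domain = {y. y$1$1 > 0 \<and> y$2$2 > 0 \<and> schur33 y > 0}"

lemma Ck_on_schur33:
  assumes "open U" "\<And>y. y \<in> U \<Longrightarrow> y$1$1 > 0 \<and> y$2$2 > 0"
  shows "Ck_on k U schur33"
  unfolding schur33_def[abs_def]
  by (rule Ck_on_diff Ck_on_mult Ck_on_entry Ck_on_inverse_compose assms(1)
      assms(2)[THEN conjunct1] assms(2)[THEN conjunct2] | assumption)+

lemma open_log_domain: "open log_domain"
proof -
  \<comment> \<open>\<open>schur33\<close> inverts the first two diagonal entries, so its continuity
    is used only after these are restricted to be positive.\<close>
  let ?U = "{y :: real^3^3. y$1$1 > 0} \<inter> {y. y$2$2 > 0}"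
  have o: "open ?U"
    by (intro open_Int open_Collect_less continuous_intros)
  have "Ck_on 0 ?U schur33" by (rule Ck_on_schur33[OF o]) auto
  then have "open (?U \<inter> schur33 -` {0<..})"
    by (intro continuous_open_preimage o) auto
  moreover have "?U \<inter> schur33 -` {0<..} = log_domain"
    by (auto simp: log_domain_def)
  ultimately show ?thesis by simp
qed

lemma Ck_on_log_coords: "Ck_on k log_domain log_coords"
proof -
  have pos: "y$1$1 > 0" "y$2$2 > 0" "schur33 y > 0" if "y \<in> log_domain" for y
    using that by (simp_all add: log_domain_def)
  have schur: "Ck_on k log_domain schur33"
    by (rule Ck_on_schur33[OF open_log_domain]) (simp add: pos)
  have ln: "Ck_on k log_domain (\<lambda>y. ln (y$1$1))" "Ck_on k log_domain (\<lambda>y. ln (y$2$2))"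
    "Ck_on k log_domain (\<lambda>y. ln (schur33 y))"
    using Ck_on_ln_compose[OF open_log_domain Ck_on_entry] pos(1,2)
      Ck_on_ln_compose[OF open_log_domain schur pos(3)] by blast+
  have inv: "Ck_on k log_domain (\<lambda>y. inverse (exp (f y / 2) * exp (g y / 2) * exp_quot (f y / 2 - g y / 2)))"
    if "Ck_on k log_domain f" "Ck_on k log_domain g" for f g
    by (rule Ck_on_inverse_compose[OF open_log_domain])
      (rule Ck_on_rules open_log_domain that | simp add: exp_quot_pos)+
  show ?thesis
    unfolding log_coords_def[abs_def] Let_def
    by (rule Ck_on_sym3[OF open_log_domain] Ck_on_mult[OF open_log_domain] Ck_on_entry inv ln)+
qed

lemma diffeomorphism_clan_Exp: "diffeomorphism clan_V clan_Omega clan_Exp clan_Log"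
proof -
  have Log: "clan_Log (clan_Exp x) = x" if "x \<in> clan_V" for x
    unfolding clan_Log_def by (rule the_inv_into_f_f[OF clan_Exp_inj that])
  have Exp: "clan_Exp (clan_Log y) = y" if "y \<in> clan_Omega" for y
    using that by (simp add: clan_Log_coords clan_Exp_coords log_coords_in_clan_V exp_log_coords)
  have Exp_in: "clan_Exp x \<in> clan_Omega" if "x \<in> clan_V" for x
    using that by (simp add: clan_Exp_coords exp_coords_in_clan_Omega)
  have Log_in: "clan_Log y \<in> clan_V" if "y \<in> clan_Omega" for y
    using that by (simp add: clan_Log_coords log_coords_in_clan_V)
  have "clan_Exp ` clan_V = clan_Omega"
    using Exp Exp_in Log_in by (metis image_eqI image_subsetI subsetI subset_antisym)
  moreover have "clan_Log ` clan_Omega = clan_V"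
    using Log Exp_in Log_in by (metis image_eqI image_subsetI subsetI subset_antisym)
  moreover have "smooth_map_on clan_V clan_Exp"
    unfolding smooth_map_on_def
    by (intro ballI exI[of _ UNIV] exI[of _ exp_coords])
      (simp add: Ck_on_exp_coords clan_Exp_coords)
  moreover have "smooth_map_on clan_Omega clan_Log"
    unfolding smooth_map_on_def
    by (intro ballI exI[of _ log_domain] exI[of _ log_coords])
      (simp add: Ck_on_log_coords clan_Log_coords open_log_domain, simp add: log_domain_def clan_Omega_iff)
  ultimately show ?thesis
    by (simp add: diffeomorphism_def Log Exp)
qed

section \<open>Uniqueness of the principal logarithm\<close>

text \<open>The power series of \<open>exp_quot\<close> evaluated at the operator \<open>A\<close>
  and applied to y.\<close>

definition op_exp_quot :: "('a::real_normed_vector \<Rightarrow> 'a) \<Rightarrow> 'a \<Rightarrow> 'a" where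
  "op_exp_quot A y = (\<Sum>n. (A ^^ n) y /\<^sub>R fact (Suc n))"

lemma op_exp_quot_sums:
  fixes A :: "'a::euclidean_space \<Rightarrow> 'a"
  assumes "linear A"
  shows "(\<lambda>n. (A ^^ n) y /\<^sub>R fact (Suc n)) sums op_exp_quot A y"
proof -
  \<comment> \<open>The first component of \<open>exp B (0, y)\<close> is the wanted series.\<close>
  define B where "B = (\<lambda>(x, z). (A x + z, 0 :: 'a))"
  have "linear B"
    unfolding B_def case_prod_beta
    by (rule linearI) (simp_all add: linear_add[OF assms] linear_scale[OF assms] algebra_simps)
  from bounded_linear.sums[OF bounded_linear_fst op_exp_sums[OF this, of "(0, y)"]]
  have "summable (\<lambda>n. fst ((B ^^ n) (0, y) /\<^sub>R fact n))" by (rule sums_summable)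
  then have "summable (\<lambda>n. fst ((B ^^ Suc n) (0, y) /\<^sub>R fact (Suc n)))" by (subst summable_Suc_iff)
  moreover have "(B ^^ Suc n) (0, y) = ((A ^^ n) y, 0)" for n
    by (induction n) (simp_all add: B_def linear_0[OF assms])
  ultimately have "summable (\<lambda>n. (A ^^ n) y /\<^sub>R fact (Suc n))" by (simp only: fst_scaleR fst_conv)
  then show ?thesis unfolding op_exp_quot_def by (rule summable_sums)
qed

text \<open>The operator form of s \<open>exp_quot\<close> s = exp s - 1: the extra \<open>A\<close>
  shifts the index and the constant term drops out.\<close>

lemma op_exp_quot_apply:
  fixes A :: "'a::euclidean_space \<Rightarrow> 'a"
  assumes "linear A"
  shows "op_exp_quot A (A y) = op_exp A y - y"
proof -
  have "(\<lambda>n. (A ^^ Suc n) y /\<^sub>R fact (Suc n)) sums (op_exp A y - y)"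
    using op_exp_sums[OF assms, of y] by (subst sums_Suc_iff) simp
  then have "(\<lambda>n. (A ^^ n) (A y) /\<^sub>R fact (Suc n)) sums (op_exp A y - y)"
    by (simp only: funpow_Suc_right o_apply)
  from sums_unique2[OF op_exp_quot_sums[OF assms] this] show ?thesis .
qed

lemma funpow_commute_linear:
  fixes A :: "'a \<Rightarrow> 'a"
  assumes "\<And>z. L (A z) = A (L z)"
  shows "(A ^^ n) (L y) = L ((A ^^ n) y)"
  by (induction n) (simp_all add: assms)

text \<open>With L a complex scalar or \<open>A\<close> itself, this makes the kernel of
  \<open>op_exp_quot A\<close> an invariant complex subspace.\<close>

lemma op_exp_quot_commute:
  fixes A :: "'a::euclidean_space \<Rightarrow> 'a"
  assumes "linear A" "linear L" "\<And>z. L (A z) = A (L z)"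
  shows "op_exp_quot A (L y) = L (op_exp_quot A y)"
proof -
  have "(\<lambda>n. L ((A ^^ n) y /\<^sub>R fact (Suc n))) sums L (op_exp_quot A y)"
    using assms(2) by (intro bounded_linear.sums[OF _ op_exp_quot_sums[OF assms(1)]])
      (simp add: linear_conv_bounded_linear)
  then have "(\<lambda>n. (A ^^ n) (L y) /\<^sub>R fact (Suc n)) sums L (op_exp_quot A y)"
    by (simp only: funpow_commute_linear[of L A, OF assms(3)] linear_scale[OF assms(2)])
  from sums_unique2[OF op_exp_quot_sums[OF assms(1)] this] show ?thesis .
qed

lemma funpow_add_linear:
  fixes A :: "'a::real_vector \<Rightarrow> 'a"
  assumes "linear A"
  shows "(A ^^ n) (x + y) = (A ^^ n) x + (A ^^ n) y"
  by (induction n) (simp_all add: linear_add[OF assms])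

lemma op_exp_quot_add:
  fixes A :: "'a::euclidean_space \<Rightarrow> 'a"
  assumes "linear A"
  shows "op_exp_quot A (x + y) = op_exp_quot A x + op_exp_quot A y"
proof -
  have "(\<lambda>n. (A ^^ n) (x + y) /\<^sub>R fact (Suc n)) sums (op_exp_quot A x + op_exp_quot A y)"
    using sums_add[OF op_exp_quot_sums[OF assms] op_exp_quot_sums[OF assms]]
    by (simp only: funpow_add_linear[OF assms] scaleR_add_right)
  from sums_unique2[OF op_exp_quot_sums[OF assms] this] show ?thesis .
qed

lemma funpow_eigenvector:
  fixes A :: "'a::real_vector \<Rightarrow> 'a"
  assumes "linear A" "A z = s *\<^sub>R z"
  shows "(A ^^ n) z = s ^ n *\<^sub>R z"
  by (induction n) (simp_all add: linear_scale[OF assms(1)] assms(2) mult.commute)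

lemma op_exp_quot_eigenvector:
  fixes A :: "'a::euclidean_space \<Rightarrow> 'a"
  assumes "linear A" "A z = s *\<^sub>R z"
  shows "op_exp_quot A z = exp_quot s *\<^sub>R z"
proof -
  have "(\<lambda>n. (inverse (fact (Suc n)) * s ^ n) *\<^sub>R z) sums (exp_quot s *\<^sub>R z)"
    by (rule bounded_linear.sums[OF bounded_linear_scaleR_left exp_quot_sums])
  then have "(\<lambda>n. (A ^^ n) z /\<^sub>R fact (Suc n)) sums (exp_quot s *\<^sub>R z)"
    by (simp only: funpow_eigenvector[OF assms] scaleR_scaleR)
  from sums_unique2[OF op_exp_quot_sums[OF assms(1)] this] show ?thesis .
qed

text \<open>Uniqueness for the linear equation replaces a product of exponential series: the scalar
  factor contributes the summand - s.\<close>

lemma op_exp_shift: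
  fixes A :: "'a::euclidean_space \<Rightarrow> 'a"
  assumes "linear A"
  shows "op_exp (\<lambda>z. A z - s *\<^sub>R z) y = exp (- s) *\<^sub>R op_exp A y"
proof -
  define g where "g t = exp (- (t * s)) *\<^sub>R op_exp (\<lambda>z. t *\<^sub>R A z) y" for t
  have g': "(g has_vector_derivative A (g t) - s *\<^sub>R g t) (at t)" for t
  proof -
    have "((\<lambda>t. exp (- (t * s))) has_real_derivative - s * exp (- (t * s))) (at t)"
      by (auto intro!: derivative_eq_intros)
    from has_vector_derivative_scaleR[OF this op_exp_has_vector_derivative[OF assms]]
    show ?thesis
      by (simp add: g_def[abs_def] linear_scale[OF assms])
  qed
  have lin: "linear (\<lambda>z. A z - s *\<^sub>R z)"
    by (intro linear_compose_sub assms linear_scale_self)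
  have "g 0 = y" by (simp add: g_def op_exp_zero)
  from op_exp_ode_unique[where g = g, OF lin g' this]
  have "op_exp (\<lambda>z. A z - s *\<^sub>R z) y = g 1" .
  then show ?thesis by (simp add: g_def)
qed

section \<open>Polynomials and eigenvectors of a complex operator\<close>

lemma scaleR_eq_smult: "r *\<^sub>R z = complex_of_real r *s z" for z :: "complex^'n"
  by (simp only: vec_eq_iff vector_scaleR_component vector_smult_component scaleR_conv_of_real[where 'a = complex]) simp

text \<open>The vector p(A) v in Horner form.\<close>

definition poly_op :: "(complex^'n \<Rightarrow> complex^'n) \<Rightarrow> complex poly \<Rightarrow> complex^'n \<Rightarrow> complex^'n" where
  "poly_op A p v = fold_coeffs (\<lambda>a w. a *s v + A w) p 0"

text \<open>Complex homogeneity is assumed separately because \<open>linear\<close> refers to real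
  scalars.\<close>

context
  fixes A :: "complex^'n \<Rightarrow> complex^'n"
  assumes add: "\<And>x y. A (x + y) = A x + A y" and scale: "\<And>c x. A (c *s x) = c *s A x"
begin

lemma poly_op_0: "poly_op A 0 v = 0"
  by (simp add: poly_op_def)

lemma poly_op_pCons: "poly_op A (pCons a p) v = a *s v + A (poly_op A p v)"
\<comment> \<open>For the zero polynomial \<open>fold_coeffs\<close> performs no step, so this case
  rests on A 0 = 0.\<close>
proof (cases "p = 0 \<and> a = 0")
  case True
  then show ?thesis using scale[of 0 0] by (simp add: poly_op_0)
next
  case False
  then show ?thesis by (auto simp: poly_op_def)
qed

lemma poly_op_add: "poly_op A (p + q) v = poly_op A p v + poly_op A q v"
  by (induction p q rule: poly_induct2)
    (simp_all add: poly_op_0 poly_op_pCons add vector_sadd_rdistrib)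

lemma poly_op_smult: "poly_op A (smult c p) v = c *s poly_op A p v"
  by (induction p)
    (simp_all add: poly_op_0 poly_op_pCons scale vector_add_ldistrib vector_smult_assoc)

lemma poly_op_monom: "poly_op A (monom c n) v = c *s (A ^^ n) v"
proof (induction n)
  case 0
  show ?case using scale[of 0 0] by (simp add: monom_0 poly_op_pCons poly_op_0)
qed (simp add: monom_Suc poly_op_pCons scale)

lemma poly_op_sum: "poly_op A (\<Sum>i\<in>I. f i) v = (\<Sum>i\<in>I. poly_op A (f i) v)"
  by (induction I rule: infinite_finite_induct) (simp_all add: poly_op_0 poly_op_add)

text \<open>There are more iterates of v than the real dimension. Distinct ones are linearly
  dependent, and a repetition gives a difference of two monomials; the cases are split because
  dependence speaks of the set of iterates.\<close>

lemma annihilating_poly: "\<exists>p. p \<noteq> 0 \<and> poly_op A p v = 0"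
proof -
  define N where "N = DIM(complex^'n)"
  define f where "f i = (A ^^ i) v" for i
  show ?thesis
  proof (cases "inj_on f {..N}")
    case True
    then have "card (f ` {..N}) > N" by (simp add: card_image)
    then have "dependent (f ` {..N})"
      using independent_bound[of "f ` {..N}"] by (auto simp: N_def)
    then obtain u where u: "\<exists>x\<in>f ` {..N}. u x \<noteq> 0" "(\<Sum>x\<in>f ` {..N}. u x *\<^sub>R x) = 0"
      by (auto simp: dependent_finite)
    define p where "p = (\<Sum>i\<le>N. monom (complex_of_real (u (f i))) i)"
    have "coeff p i = complex_of_real (u (f i))" if "i \<le> N" for i
      using that by (simp add: p_def coeff_sum)
    then have "p \<noteq> 0" using u(1) by fastforce
    moreover have "poly_op A p v = (\<Sum>i\<le>N. u (f i) *\<^sub>R f i)"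
      by (simp add: p_def poly_op_sum poly_op_monom f_def scaleR_eq_smult)
    then have "poly_op A p v = 0"
      using u(2) by (simp add: sum.reindex[OF True])
    ultimately show ?thesis by blast
  next
    case False
    then obtain i j where ij: "i \<noteq> j" "f i = f j" by (auto simp: inj_on_def)
    define p where "p = monom (1::complex) i + monom (- 1) j"
    have "coeff p i = 1" using ij by (simp add: p_def)
    then have "p \<noteq> 0" by auto
    moreover have "poly_op A p v = 0"
      using ij by (simp add: p_def poly_op_add poly_op_monom f_def)
    ultimately show ?thesis by blast
  qed
qed

text \<open>Split a root l off an annihilating polynomial, leaving q. Either q(A) v is nonzero,
  hence an eigenvector in \<open>W\<close> for l, or q annihilates v and has smaller degree.\<close>

lemma eigenvector_in_invariant_set:
  assumes W: "\<And>x y. x \<in> W \<Longrightarrow> y \<in> W \<Longrightarrow> x + y \<in> W" "\<And>c x. x \<in> W \<Longrightarrow> c *s x \<in> W"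
      "\<And>x. x \<in> W \<Longrightarrow> A x \<in> W"
    and v: "v \<in> W" "v \<noteq> 0"
  obtains l z where "z \<in> W" "z \<noteq> 0" "A z = l *s z"
proof -
  have W0: "0 \<in> W" using W(2)[OF v(1), of 0] by simp
  have in_W: "poly_op A p v \<in> W" for p
    by (induction p) (simp_all add: poly_op_0 poly_op_pCons W W0 v)
  have "\<exists>l z. z \<in> W \<and> z \<noteq> 0 \<and> A z = l *s z" if "p \<noteq> 0" "poly_op A p v = 0" for p
    using that
  proof (induction "degree p" arbitrary: p)
    case 0
    then obtain a where "p = [:a:]" by (metis degree_eq_zeroE)
    with 0 v scale[of 0 0] show ?case by (simp add: poly_op_pCons poly_op_0)
  next
    case (Suc n)
    then have "\<not> constant (poly p)" by (simp add: constant_degree)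
    then obtain l where "poly p l = 0" using fundamental_theorem_of_algebra by blast
    then obtain q where p: "p = [:- l, 1:] * q" by (auto simp: poly_eq_0_iff_dvd)
    have "q \<noteq> 0" using Suc.prems p by auto
    have "degree p = Suc (degree q)"
      unfolding p using \<open>q \<noteq> 0\<close> by (subst degree_mult_eq) auto
    then have deg: "n = degree q" using Suc.hyps by simp
    have "p = smult (- l) q + pCons 0 q" by (simp add: p)
    then have "poly_op A p v = - l *s poly_op A q v + A (poly_op A q v)"
      by (simp only: poly_op_add poly_op_smult poly_op_pCons) simp
    then have "A (poly_op A q v) = l *s poly_op A q v" using Suc.prems(2) by simp
    then show ?case
      using Suc.hyps(1)[OF deg \<open>q \<noteq> 0\<close>] in_W[of q] by blast
  qed
  then show ?thesis using annihilating_poly[of v] that by blast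
qed

lemma linear_real: "linear A"
  by (rule linearI) (simp_all add: add scale scaleR_eq_smult)

text \<open>A nonzero kernel would contain an eigenvector, on which the operator acts by a value of
  \<open>exp_quot\<close>. Real eigenvalues matter here: the complex function vanishes at nonzero
  multiples of 2 pi i.\<close>

lemma op_exp_quot_inj:
  assumes real: "\<And>l z. z \<noteq> 0 \<Longrightarrow> A z = l *s z \<Longrightarrow> Im l = 0"
    and eq: "op_exp_quot A x = op_exp_quot A y"
  shows "x = y"
proof (rule ccontr)
  assume "x \<noteq> y"
  define W where "W = {z. op_exp_quot A z = 0}"
  have smult: "linear (\<lambda>z :: complex^'n. c *s z)" for c
    by (rule linearI) (simp_all add: vector_add_ldistrib scaleR_eq_smult vector_smult_assoc mult.commute)
  have "x - y \<in> W"
    using op_exp_quot_add[OF linear_real, of "x - y" y] eq by (simp add: W_def)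
  moreover have "u + v \<in> W" if "u \<in> W" "v \<in> W" for u v
    using that by (simp add: W_def op_exp_quot_add[OF linear_real])
  moreover have "c *s u \<in> W" if "u \<in> W" for c u
    using that op_exp_quot_commute[OF linear_real smult, of c u] by (simp add: W_def scale)
  moreover have "A u \<in> W" if "u \<in> W" for u
    using that op_exp_quot_commute[OF linear_real linear_real refl, of u]
    by (simp add: W_def linear_0[OF linear_real])
  ultimately obtain l z where z: "z \<in> W" "z \<noteq> 0" "A z = l *s z"
    using eigenvector_in_invariant_set[of W "x - y"] \<open>x \<noteq> y\<close> by (metis eq_iff_diff_eq_0)
  have "l = complex_of_real (Re l)"
    using real[OF z(2,3)] by (simp add: complex_eq_iff)
  then have "A z = Re l *\<^sub>R z" using z(3) by (simp only: scaleR_eq_smult)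
  from op_exp_quot_eigenvector[OF linear_real this] show False
    using z(1,2) exp_quot_pos[of "Re l"] by (simp add: W_def)
qed

lemma op_exp_eigenvector:
  assumes "A z = l *s z"
  shows "op_exp A z = exp l *s z"
proof -
  have "(A ^^ n) z = l ^ n *s z" for n
    by (induction n) (simp_all add: scale assms vector_smult_assoc mult.commute)
  moreover have "linear (\<lambda>c. c *s z)"
    by (rule linearI) (simp_all add: vector_sadd_rdistrib scaleR_eq_smult scaleR_conv_of_real vector_smult_assoc)
  then have "bounded_linear (\<lambda>c. c *s z)" by (simp add: linear_conv_bounded_linear)
  from bounded_linear.sums[OF this exp_converges, of l]
  have "(\<lambda>n. (l ^ n /\<^sub>R fact n) *s z) sums (exp l *s z)" .
  ultimately have "(\<lambda>n. (A ^^ n) z /\<^sub>R fact n) sums (exp l *s z)"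
    by (simp add: scaleR_eq_smult scaleR_conv_of_real vector_smult_assoc)
  from sums_unique2[OF op_exp_sums[OF linear_real] this] show ?thesis .
qed

end

text \<open>The real-linear map L carries the matrix exponential series termwise to the operator
  series, moving the problem to complex vectors, where eigenvectors exist.\<close>

lemma op_exp_complexification:
  "op_exp ((*v) (map_matrix complex_of_real X)) z = map_matrix complex_of_real (matrix_exp X) *v z"
proof -
  define L where "L A = map_matrix complex_of_real A *v z" for A :: "real^'a^'a"
  have L: "linear L"
    by (rule linearI) (simp_all add: L_def vec_eq_iff matrix_vector_mult_def
        algebra_simps sum.distrib sum_distrib_left scaleR_conv_of_real[where 'a = complex])
  have pow: "((*v) (map_matrix complex_of_real X) ^^ n) z = L (((**) X ^^ n) (mat 1))" for n
  proof (induction n)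
    case 0
    have "map_matrix complex_of_real (mat 1 :: real^'a^'a) = mat 1"
      by (simp add: vec_eq_iff mat_def)
    then show ?case by (simp add: L_def)
  next
    case (Suc n)
    have "map_matrix complex_of_real (X ** B) = map_matrix complex_of_real X ** map_matrix complex_of_real B"
      for B :: "real^'a^'a"
      by (simp add: vec_eq_iff matrix_matrix_mult_def)
    then show ?case by (simp add: L_def Suc matrix_vector_mul_assoc)
  qed
  have lin: "linear ((*v) (map_matrix complex_of_real X))"
    by (rule linear_real) (simp_all add: matrix_vector_right_distrib vector_scalar_commute)
  have "(\<lambda>n. L (((**) X ^^ n) (mat 1) /\<^sub>R fact n)) sums L (matrix_exp X)"
    using L by (intro bounded_linear.sums[OF _ matrix_exp_sums]) (simp add: linear_conv_bounded_linear)
  then have "(\<lambda>n. ((*v) (map_matrix complex_of_real X) ^^ n) z /\<^sub>R fact n) sums L (matrix_exp X)"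
    by (simp only: pow linear_scale[OF L])
  from sums_unique2[OF op_exp_sums[OF lin] this] show ?thesis by (simp add: L_def)
qed

lemma complex_low_mult:
  "map_matrix complex_of_real (low a b c p q) *v z =
    vector [of_real a * z$1, of_real b * z$2, of_real p * z$1 + of_real q * z$2 + of_real c * z$3]"
  by (simp add: vec_eq_iff forall_3 matrix_vector_mult_def sum_3)

text \<open>The row of the first nonzero coordinate of an eigenvector determines the
  eigenvalue.\<close>

lemma complex_eigenvalue_low:
  assumes "complex_eigenvalue (low a b c p q) l"
  shows "l \<in> {of_real a, of_real b, of_real c}"
proof -
  obtain z :: "complex^3" where z: "z \<noteq> 0" "map_matrix complex_of_real (low a b c p q) *v z = l *s z"
    using assms by (auto simp: complex_eigenvalue_def)
  from z(2) have "of_real a * z$1 = l * z$1" "of_real b * z$2 = l * z$2"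
    "of_real p * z$1 + of_real q * z$2 + of_real c * z$3 = l * z$3"
    by (simp_all add: complex_low_mult vec_eq_iff forall_3)
  with z(1) show ?thesis
    by (cases "z$1 = 0"; cases "z$2 = 0") (auto simp: vec_eq_iff forall_3)
qed

text \<open>On the open strip \<open>Ln\<close> inverts \<open>exp\<close>, and it is real at
  positive reals.\<close>

lemma exp_real_pos_imp_real:
  assumes "exp l = complex_of_real r" "r > 0" "\<bar>Im l\<bar> < pi"
  shows "Im l = 0"
proof -
  have "l = Ln (exp l)" using assms(3) by (intro Ln_exp[symmetric]) auto
  also have "\<dots> = of_real (ln r)" using assms by (simp add: Ln_of_real)
  finally show ?thesis by (metis Im_complex_of_real)
qed

lemma exp_mult_exp_quot_minus: "exp (- s) * exp_quot s = exp_quot (- s)"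
  by (simp add: exp_quot_def exp_minus field_simps)

text \<open>The last basis vector comes first: it is an eigenvector, and the other two columns of
  the exponential involve only their own basis vector and this one.\<close>

lemma matrix_exp_eq_low_unique:
  assumes X: "matrix_exp X = matrix_exp (low a b c p q)"
    and strip: "\<And>l. complex_eigenvalue X l \<Longrightarrow> \<bar>Im l\<bar> < pi"
  shows "X = low a b c p q"
proof -
  define T where "T = (*v) (map_matrix complex_of_real X)"
  have add: "T (x + y) = T x + T y" and scale: "T (r *s x) = r *s T x" for x y r
    by (simp_all add: T_def matrix_vector_right_distrib vector_scalar_commute)
  note lin = linear_real[of T, OF add scale]
  have E: "op_exp T z = map_matrix complex_of_real (matrix_exp (low a b c p q)) *v z" for z
    by (simp add: T_def op_exp_complexification X)
  have real: "Im l = 0" if z: "z \<noteq> 0" "T z = l *s z" for l z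
  proof -
    have "complex_eigenvalue X l" using z by (auto simp: complex_eigenvalue_def T_def)
    then have "\<bar>Im l\<bar> < pi" by (rule strip)
    moreover have "complex_eigenvalue (matrix_exp (low a b c p q)) (exp l)"
      using z op_exp_eigenvector[of T, OF add scale z(2)] unfolding complex_eigenvalue_def E by blast
    then have "exp l \<in> {of_real (exp a), of_real (exp b), of_real (exp c)}"
      unfolding matrix_exp_low by (rule complex_eigenvalue_low)
    ultimately show ?thesis using exp_real_pos_imp_real[of l] by auto
  qed
  define S where "S s z = T z - s *\<^sub>R z" for s z
  have S_add: "S s (x + y) = S s x + S s y" and S_scale: "S s (r *s x) = r *s S s x" for s x y r
    by (simp_all add: S_def add scale scaleR_add_right vector_ssub_ldistrib scaleR_eq_smult[of s]
        vector_smult_assoc mult.commute)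
  have S_real: "Im l = 0" if "z \<noteq> 0" "S s z = l *s z" for s l z
  proof -
    have "T z = (l + of_real s) *s z"
      using that(2) by (simp add: S_def scaleR_eq_smult vector_sadd_rdistrib algebra_simps)
    from real[OF that(1) this] show ?thesis by simp
  qed
  note S_lin = linear_real[of "S s" for s, OF S_add S_scale]
  \<comment> \<open>To find S s x it is enough to guess y and compare images under the injective
    operator \<open>op_exp_quot (S s)\<close>.\<close>
  have S_eq: "S s x = y" if "op_exp_quot (S s) y = op_exp (S s) x - x" for s x y
  proof (rule op_exp_quot_inj[of "S s", OF S_add S_scale S_real])
    show "op_exp_quot (S s) (S s x) = op_exp_quot (S s) y"
      unfolding that by (rule op_exp_quot_apply[OF S_lin])
  qed
  have S_exp: "op_exp (S s) z = exp (- s) *\<^sub>R op_exp T z" for s z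
    unfolding S_def[abs_def] by (rule op_exp_shift[OF lin])
  define e :: "3 \<Rightarrow> complex^3" where "e k = axis k 1" for k
  have e: "e 1 = vector [1, 0, 0]" "e 2 = vector [0, 1, 0]" "e 3 = vector [0, 0, 1]"
    by (simp_all add: e_def vec_eq_iff forall_3 axis_def)
  have "op_exp_quot (S c) 0 = 0" by (rule op_exp_quot_eigenvector[of "S c" 0 0, OF S_lin, simplified])
    (simp add: linear_0[OF S_lin])
  moreover have "op_exp (S c) (e 3) = e 3"
    by (simp add: S_exp E matrix_exp_low complex_low_mult e vec_eq_iff forall_3 exp_minus
        scaleR_conv_of_real[where 'a = complex])
  ultimately have T3: "T (e 3) = c *\<^sub>R e 3"
    using S_eq[of c 0 "e 3"] by (simp add: S_def)
  \<comment> \<open>Shifting by the diagonal entry s removes the e k component of exp (S s) (e k) -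
    e k. What remains is a multiple of e 3, an eigenvector of S s with eigenvalue c - s.\<close>
  have column: "T (e k) = s *\<^sub>R e k + r *\<^sub>R e 3"
    if k: "op_exp T (e k) = exp s *\<^sub>R e k + (r * exp c * exp_quot (s - c)) *\<^sub>R e 3" for k s r
  proof -
    have "S s (r *\<^sub>R e 3) = (c - s) *\<^sub>R (r *\<^sub>R e 3)"
      by (simp add: S_def linear_scale[OF lin] T3 algebra_simps)
    then have "op_exp_quot (S s) (r *\<^sub>R e 3) = exp_quot (c - s) *\<^sub>R (r *\<^sub>R e 3)"
      by (rule op_exp_quot_eigenvector[OF S_lin])
    moreover have "exp (- s) * (r * exp c * exp_quot (s - c)) = exp_quot (c - s) * r"
      using exp_mult_exp_quot_minus[of "s - c"] by (simp add: mult_ac exp_diff exp_minus field_simps)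
    then have "op_exp (S s) (e k) - e k = exp_quot (c - s) *\<^sub>R (r *\<^sub>R e 3)"
      by (simp add: S_exp k scaleR_add_right flip: exp_add)
    ultimately have "S s (e k) = r *\<^sub>R e 3" by (intro S_eq) simp
    then show ?thesis by (simp add: S_def algebra_simps)
  qed
  have T1: "T (e 1) = a *\<^sub>R e 1 + p *\<^sub>R e 3" and T2: "T (e 2) = b *\<^sub>R e 2 + q *\<^sub>R e 3"
    by (rule column; simp add: E matrix_exp_low complex_low_mult e vec_eq_iff forall_3
        scaleR_conv_of_real[where 'a = complex])+
  have "T (e k) $ i = of_real (X $ i $ k)" for i k
    by (simp add: T_def e_def matrix_vector_mult_def axis_def if_distrib cong: if_cong)
  then have "of_real (X $ i $ k) = T (e k) $ i" for i k by simp
  then have "complex_of_real (X $ i $ k) = of_real (low a b c p q $ i $ k)" for i k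
    using exhaust_3[of i] exhaust_3[of k] by (auto simp: T1 T2 T3) (auto simp: e scaleR_conv_of_real[where 'a = complex])
  then show ?thesis by (simp add: vec_eq_iff)
qed

text \<open>A matrix in h has real eigenvalues, so it lies in the strip and is itself the unique
  candidate.\<close>

lemma principal_log_matrix_exp_low:
  "principal_log (matrix_exp (low a b c p q)) = low a b c p q"
  unfolding principal_log_def
proof (rule the_equality)
  show "matrix_exp (low a b c p q) = matrix_exp (low a b c p q) \<and>
      (\<forall>z. complex_eigenvalue (low a b c p q) z \<longrightarrow> \<bar>Im z\<bar> < pi)"
    using complex_eigenvalue_low by fastforce
qed (blast intro: matrix_exp_eq_low_unique)

section \<open>The clan exponential\<close>

lemma op_exp_scaleR_clan_L:
  "op_exp (\<lambda>z. t *\<^sub>R clan_L x z) y =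
    matrix_exp (t *\<^sub>R lower_part x) ** y ** transpose (matrix_exp (t *\<^sub>R lower_part x))"
proof -
  let ?u = "t *\<^sub>R lower_part x"
  have "transpose ?u = t *\<^sub>R transpose (lower_part x)"
    by (rule linear_scale[OF bounded_linear.linear[OF bounded_linear_transpose]])
  then have "(\<lambda>z. t *\<^sub>R clan_L x z) = (\<lambda>z. ?u ** z + z ** transpose ?u)"
    by (simp add: clan_L_def clan_prod_def scaleR_add_right matrix_scaleR_mult
        bounded_bilinear.scaleR_right[OF bounded_bilinear_matrix_mult])
  then show ?thesis by (simp only: op_exp_congruence)
qed

lemma clan_Log_principal_log:
  assumes "x \<in> clan_Omega"
  shows "clan_Log x = principal_log (cholesky x) + transpose (principal_log (cholesky x))"
proof -
  have V: "clan_Log x \<in> clan_V" and Exp: "clan_Exp (clan_Log x) = x"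
    using assms diffeomorphism_clan_Exp by (auto simp: diffeomorphism_def)
  obtain a b c p q where Log: "clan_Log x = sym3 a b c p q" using V by (rule clan_V_cases)
  \<comment> \<open>This is the lower part of \<open>clan_Log x\<close>; its exponential is the
    Cholesky factor of x, so the principal logarithm returns it.\<close>
  let ?u = "low (a / 2) (b / 2) (c / 2) p q"
  have "clan_Phi (matrix_exp ?u) = x"
    using Exp by (simp add: clan_Exp_eq Log lower_part_sym3)
  moreover have "matrix_exp ?u \<in> clan_H"
    using matrix_exp_lower_part_in_clan_H[OF V] by (simp add: Log lower_part_sym3)
  ultimately have "cholesky x = matrix_exp ?u" using cholesky_clan_Phi by metis
  then show ?thesis by (simp add: Log principal_log_matrix_exp_low low_add_transpose)
qed

theorem proposition3p3:
  shows "(\<forall>x\<in>clan_V. \<forall>y\<in>clan_V. \<forall>t::real.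
            op_exp (\<lambda>z. t *\<^sub>R clan_L x z) y =
              matrix_exp (t *\<^sub>R lower_part x) ** y ** transpose (matrix_exp (t *\<^sub>R lower_part x)))
       \<and> (\<forall>x\<in>clan_V.
            clan_Exp x = matrix_exp (lower_part x) ** transpose (matrix_exp (lower_part x)) \<and>
            matrix_exp (lower_part x) \<in> clan_H \<and>
            clan_Exp x = clan_Phi (matrix_exp (lower_part x)))
       \<and> diffeomorphism clan_V clan_Omega clan_Exp clan_Log
       \<and> (\<forall>x\<in>clan_Omega.
            clan_Log x = principal_log (cholesky x) + transpose (principal_log (cholesky x)))"
  using op_exp_scaleR_clan_L clan_Exp_eq matrix_exp_lower_part_in_clan_H diffeomorphism_clan_Exp
    clan_Log_principal_log
  by (simp add: clan_Phi_def)

end
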